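(* Let $p$ be a prime and $H$ a finite $p$-group of nilpotency class at most 2 such that $H \in \mathcal{CD}(H)$ and $H/\mathrm{Z}(H)$ is elementary abelian. Then there exist a finite $p$-group $G$ of class 2, an embedding of $H$ into $G$ (whose image will also be denoted by $H$), and a normal subgroup $N$ of $G$ with $N \cap H = 1$, $N\mathrm{Z}(H) > \mathrm{Z}(G)$ (proper containment) and $NH < G$ (proper containment), such that $G/\mathrm{Z}(G)$ is elementary abelian and $$\mathcal{CD}(G) = \{G, \mathrm{Z}(G)\} \cup \{ N\tilde{H} \mid \tilde{H} \in \mathcal{CD}(H)\}.$$ Moreover, $\mathrm{Z}(G)$ is elementary abelian when $\mathrm{Z}(H)$ is elementary abelian.
   Context: For a finite group $G$ and a subgroup $U \le G$, the Chermak-Delgado measure of $U$ in $G$ is $m_G(U) = |U|\,|C_G(U)|$. Put $m(G) = \max\{m_G(U) \mid U \le G\}$ and $\mathcal{CD}(G) = \{U \le G \mid m_G(U) = m(G)\}$; this set is the Chermak-Delgado lattice of $G$ (a sublattice of the subgroup lattice of $G$). $\mathrm{Z}(G)$ denotes the center of $G$. The trivial group counts as elementary abelian. *)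

theory Defs
  imports "HOL-Algebra.Algebra" "HOL-Computational_Algebra.Primes"
begin

definition finite_p_group :: "nat \<Rightarrow> ('a, 'b) monoid_scheme \<Rightarrow> bool" where
  "finite_p_group p G \<longleftrightarrow> group G \<and> finite (carrier G) \<and> (\<exists>n. order G = p ^ n)"

(* The trivial group is elementary abelian for every p. *)
definition elementary_abelian :: "nat \<Rightarrow> ('a, 'b) monoid_scheme \<Rightarrow> bool" where
  "elementary_abelian p G \<longleftrightarrow>
     comm_group G \<and> (\<forall>x \<in> carrier G. x [^]\<^bsub>G\<^esub> p = \<one>\<^bsub>G\<^esub>)"

definition centralizer :: "('a, 'b) monoid_scheme \<Rightarrow> 'a set \<Rightarrow> 'a set" where
  "centralizer G U = {g \<in> carrier G. \<forall>u \<in> U. g \<otimes>\<^bsub>G\<^esub> u = u \<otimes>\<^bsub>G\<^esub> g}"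

definition center :: "('a, 'b) monoid_scheme \<Rightarrow> 'a set" where
  "center G = centralizer G (carrier G)"

(* Indexed from 0, so that the nilpotency class is the least c at which the series is trivial;
   the trivial group has class 0. *)
primrec lower_central :: "('a, 'b) monoid_scheme \<Rightarrow> nat \<Rightarrow> 'a set" where
  "lower_central G 0 = carrier G"
| "lower_central G (Suc n) = generate G
     (\<Union>x \<in> lower_central G n. \<Union>y \<in> carrier G.
        {x \<otimes>\<^bsub>G\<^esub> y \<otimes>\<^bsub>G\<^esub> inv\<^bsub>G\<^esub> x \<otimes>\<^bsub>G\<^esub> inv\<^bsub>G\<^esub> y})"

definition nilpotent :: "('a, 'b) monoid_scheme \<Rightarrow> bool" where
  "nilpotent G \<longleftrightarrow> (\<exists>c. lower_central G c = {\<one>\<^bsub>G\<^esub>})"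

(* Meaningful only for nilpotent G. *)
definition nilpotency_class :: "('a, 'b) monoid_scheme \<Rightarrow> nat" where
  "nilpotency_class G = (LEAST c. lower_central G c = {\<one>\<^bsub>G\<^esub>})"

definition CD_measure :: "('a, 'b) monoid_scheme \<Rightarrow> 'a set \<Rightarrow> nat" where
  "CD_measure G U = card U * card (centralizer G U)"

definition CD_max :: "('a, 'b) monoid_scheme \<Rightarrow> nat" where
  "CD_max G = Max {CD_measure G U | U. subgroup U G}"

definition CD_lattice :: "('a, 'b) monoid_scheme \<Rightarrow> 'a set set" where
  "CD_lattice G = {U. subgroup U G \<and> CD_measure G U = CD_max G}"

end

theory Submission
  imports Defs
begin

text \<open>
  Put \<open>C = \<int>/p\<close>, \<open>L = H \<times> C\<^sup>2\<close> and \<open>R = H/Z(H) \<times> C\<^sup>2\<close>, with the obvious surjection \<open>\<eta> : L \<rightarrow> R\<close>.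
  The group \<open>G\<close> is the central extension of \<open>L \<times> C\<^sup>2\<close> by \<open>R\<^sup>2 \<times> C\<close> in which, for
  \<open>(l, a)\<close>, \<open>(l', a')\<close> with \<open>l\<close>, \<open>l'\<close> commuting, the commutator records \<open>\<eta>(l)\<close> to the power \<open>a'\<^sub>i\<close>
  divided by \<open>\<eta>(l')\<close> to the power \<open>a\<^sub>i\<close> for \<open>i = 1, 2\<close>, together with the determinant of \<open>a\<close> and \<open>a'\<close>.
  Then \<open>Z(G)\<close> is the part over \<open>ker \<eta> = Z(H)\<close>, \<open>a = 0\<close>; we take for \<open>N\<close> the part over
  \<open>1 \<times> C\<^sup>2 \<le> L\<close>, \<open>a = 0\<close>. So \<open>C\<^sub>G(N) = NH\<close> is the part with \<open>a = 0\<close>, and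
  \<open>|G| |Z(G)| = |N|\<^sup>2 |H| |Z(H)|\<close>.

  The commutators are generic enough that an element \<open>u\<close> outside \<open>NH\<close> satisfies \<open>C\<^sub>G(u) = \<langle>u\<rangle> Z(G)\<close>.
  If \<open>U\<close> and \<open>C\<^sub>G(U)\<close> both lie in \<open>NH = N \<times> H\<close>, the measure of \<open>U\<close> is at most \<open>|N|\<^sup>2\<close> times that
  of its projection to \<open>H\<close>; otherwise one of \<open>U\<close>, \<open>C\<^sub>G(U)\<close> is central, or both have order at most
  \<open>p |Z(G)|\<close>, which is too small.
\<close>

section \<open>Chermak-Delgado measure\<close>

lemma centralizer_antimono: "U \<subseteq> V \<Longrightarrow> centralizer G V \<subseteq> centralizer G U"
  unfolding centralizer_def by auto

lemma subset_double_centralizer: "U \<subseteq> carrier G \<Longrightarrow> U \<subseteq> centralizer G (centralizer G U)"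
  unfolding centralizer_def by auto

lemma centralizer_subset: "centralizer G U \<subseteq> carrier G"
  unfolding centralizer_def by auto

lemma center_subset_centralizer: "U \<subseteq> carrier G \<Longrightarrow> center G \<subseteq> centralizer G U"
  unfolding center_def by (rule centralizer_antimono)

lemma (in group) subgroup_centralizer:
  assumes "U \<subseteq> carrier G"
  shows "subgroup (centralizer G U) G"
proof (rule subgroupI)
  show "centralizer G U \<subseteq> carrier G" by (rule centralizer_subset)
  show "centralizer G U \<noteq> {}"
    using assms unfolding centralizer_def by (auto intro!: exI[of _ \<one>])
next
  fix a assume a: "a \<in> centralizer G U"
  show "inv a \<in> centralizer G U"
    unfolding centralizer_def
  proof (safe)
    show "inv a \<in> carrier G" using a by (auto simp: centralizer_def)
    fix u assume u: "u \<in> U"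
    have "a \<otimes> u = u \<otimes> a" "a \<in> carrier G" "u \<in> carrier G"
      using a u assms by (auto simp: centralizer_def)
    then have "inv a \<otimes> (a \<otimes> u) \<otimes> inv a = inv a \<otimes> (u \<otimes> a) \<otimes> inv a" by simp
    moreover have "inv a \<otimes> (a \<otimes> u) \<otimes> inv a = u \<otimes> inv a"
      using \<open>a \<in> carrier G\<close> \<open>u \<in> carrier G\<close> by (simp add: inv_solve_left')
    moreover have "inv a \<otimes> (u \<otimes> a) \<otimes> inv a = inv a \<otimes> u"
      using \<open>a \<in> carrier G\<close> \<open>u \<in> carrier G\<close> by (simp add: m_assoc)
    ultimately show "inv a \<otimes> u = u \<otimes> inv a" by simp
  qed
next
  fix a b assume "a \<in> centralizer G U" "b \<in> centralizer G U"
  then show "a \<otimes> b \<in> centralizer G U"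
    using assms unfolding centralizer_def
    by (auto simp: subset_iff m_assoc) (simp flip: m_assoc)
qed

lemma (in group) subgroup_center: "subgroup (center G) G"
  unfolding center_def by (rule subgroup_centralizer) simp

lemma (in group) centralizer_center: "centralizer G (center G) = carrier G"
  unfolding center_def centralizer_def by auto

lemma centralizer_of_subset_center:
  assumes "U \<subseteq> center G"
  shows "centralizer G U = carrier G"
  using assms unfolding center_def centralizer_def by auto

text \<open>\<open>Max\<close> is meaningful only on finite sets; this is what licenses the rules
  for \<open>CD_max\<close> below.\<close>

lemma (in group) finite_CD_measures:
  assumes "finite (carrier G)"
  shows "finite {CD_measure G U | U. subgroup U G}"
proof -
  have "{CD_measure G U | U. subgroup U G} \<subseteq> CD_measure G ` Pow (carrier G)"
    using subgroup.subset by fastforce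
  then show ?thesis using assms finite_subset by blast
qed

lemma (in group) CD_measure_le_CD_max:
  assumes "finite (carrier G)" "subgroup U G"
  shows "CD_measure G U \<le> CD_max G"
  unfolding CD_max_def using finite_CD_measures[OF assms(1)] assms(2) by (auto intro: Max_ge)

lemma (in group) CD_max_eqI:
  assumes "finite (carrier G)" "subgroup U G" "CD_measure G U = m"
    and "\<And>V. subgroup V G \<Longrightarrow> CD_measure G V \<le> m"
  shows "CD_max G = m"
  unfolding CD_max_def
proof (rule Max_eqI[OF finite_CD_measures[OF assms(1)]])
  show "x \<le> m" if "x \<in> {CD_measure G U |U. subgroup U G}" for x
    using that assms(4) by blast
  show "m \<in> {CD_measure G U |U. subgroup U G}"
    using assms(2,3) by blast
qed

section \<open>The criterion\<close>

text \<open>Collects what the computation of the lattice needs, phrased only through orders,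
  products and centralizers, so that it can be carried along an isomorphism.
  \<open>outside_Int\<close> and \<open>outside_card\<close> are what remains of C(u) = <u> Z(G) for
  u outside NH. \<open>card_eq\<close> says that G, of measure |G| |Z(G)|, and NH, of measure |N|^2
  |H| |Z(H)|, have the same measure.\<close>

locale cd_extension = G: group G + H: group H
  for G (structure) and H (structure) +
  fixes \<phi> and N and p :: nat
  assumes finite_G: "finite (carrier G)"
    and H_in_CD: "carrier H \<in> CD_lattice H"
    and mon: "\<phi> \<in> mon H G"
    and normal_N: "N \<lhd> G"
    and N_Int: "N \<inter> \<phi> ` carrier H = {\<one>\<^bsub>G\<^esub>}"
    and N_commute: "\<lbrakk>n \<in> N; h \<in> carrier H\<rbrakk> \<Longrightarrow> n \<otimes>\<^bsub>G\<^esub> \<phi> h = \<phi> h \<otimes>\<^bsub>G\<^esub> n"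
    and centralizer_N: "centralizer G N = N <#>\<^bsub>G\<^esub> \<phi> ` carrier H"
    and N_not_central: "\<not> N \<subseteq> center G"
    and outside_Int:
      "\<lbrakk>u \<in> carrier G; u \<notin> N <#>\<^bsub>G\<^esub> \<phi> ` carrier H\<rbrakk>
        \<Longrightarrow> centralizer G {u} \<inter> (N <#>\<^bsub>G\<^esub> \<phi> ` carrier H) \<subseteq> center G"
    and outside_card:
      "\<lbrakk>u \<in> carrier G; u \<notin> N <#>\<^bsub>G\<^esub> \<phi> ` carrier H\<rbrakk>
        \<Longrightarrow> card (centralizer G {u}) \<le> p * card (center G)"
    and center_small: "p * p * card (center G) < card (carrier G)"
    and card_eq: "card (carrier G) * card (center G)
      = card N * card N * (card (carrier H) * card (center H))"
begin

section \<open>The direct product M = N x H inside G\<close>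

abbreviation M where "M \<equiv> N <#>\<^bsub>G\<^esub> \<phi> ` carrier H"

lemma phi_closed [simp, intro]: "h \<in> carrier H \<Longrightarrow> \<phi> h \<in> carrier G"
  using mon unfolding mon_def hom_def by auto

lemma phi_mult [simp]:
  "\<lbrakk>h \<in> carrier H; k \<in> carrier H\<rbrakk> \<Longrightarrow> \<phi> (h \<otimes>\<^bsub>H\<^esub> k) = \<phi> h \<otimes>\<^bsub>G\<^esub> \<phi> k"
  using mon unfolding mon_def hom_def by auto

lemma phi_inj: "\<lbrakk>h \<in> carrier H; k \<in> carrier H; \<phi> h = \<phi> k\<rbrakk> \<Longrightarrow> h = k"
  using mon unfolding mon_def inj_on_def by auto

lemma group_hom_phi: "group_hom H G \<phi>"
  using mon unfolding mon_def by unfold_locales auto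

lemmas phi_one [simp] = group_hom.hom_one[OF group_hom_phi]
lemmas phi_inv [simp] = group_hom.hom_inv[OF group_hom_phi]

lemma subgroup_N: "subgroup N G"
  by (rule normal_imp_subgroup[OF normal_N])

lemma N_closed [simp, intro]: "n \<in> N \<Longrightarrow> n \<in> carrier G"
  using subgroup_N subgroup.subset by blast

lemma N_subset_M: "N \<subseteq> M"
  using G.r_one phi_one by (force simp: set_mult_def)

text \<open>\<open>N\<close> lies in \<open>M\<close>, which is the centralizer of
  \<open>N\<close>.\<close>

lemma N_abelian: "\<lbrakk>m \<in> N; n \<in> N\<rbrakk> \<Longrightarrow> m \<otimes>\<^bsub>G\<^esub> n = n \<otimes>\<^bsub>G\<^esub> m"
  using N_subset_M centralizer_N unfolding centralizer_def by blast

lemma mult_swap: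
  assumes "n \<in> N" "h \<in> carrier H" "n' \<in> N" "h' \<in> carrier H"
  shows "(n \<otimes>\<^bsub>G\<^esub> \<phi> h) \<otimes>\<^bsub>G\<^esub> (n' \<otimes>\<^bsub>G\<^esub> \<phi> h') = (n \<otimes>\<^bsub>G\<^esub> n') \<otimes>\<^bsub>G\<^esub> \<phi> (h \<otimes>\<^bsub>H\<^esub> h')"
proof -
  have "(n \<otimes>\<^bsub>G\<^esub> \<phi> h) \<otimes>\<^bsub>G\<^esub> (n' \<otimes>\<^bsub>G\<^esub> \<phi> h') = n \<otimes>\<^bsub>G\<^esub> (\<phi> h \<otimes>\<^bsub>G\<^esub> n') \<otimes>\<^bsub>G\<^esub> \<phi> h'"
    using assms by (simp add: G.m_assoc)
  also have "\<phi> h \<otimes>\<^bsub>G\<^esub> n' = n' \<otimes>\<^bsub>G\<^esub> \<phi> h"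
    using N_commute assms by simp
  finally show ?thesis
    using assms by (simp add: G.m_assoc)
qed

text \<open>The quotient of \<open>n\<close> by \<open>n'\<close> lies both in \<open>N\<close> and
  in the image of \<open>H\<close>, hence is trivial.\<close>

lemma decomposition_unique:
  assumes "n \<in> N" "h \<in> carrier H" "n' \<in> N" "h' \<in> carrier H"
    and eq: "n \<otimes>\<^bsub>G\<^esub> \<phi> h = n' \<otimes>\<^bsub>G\<^esub> \<phi> h'"
  shows "n = n'" "h = h'"
proof -
  have "inv\<^bsub>G\<^esub> n' \<otimes>\<^bsub>G\<^esub> n = \<phi> (h' \<otimes>\<^bsub>H\<^esub> inv\<^bsub>H\<^esub> h)"
  proof -
    have "n = n' \<otimes>\<^bsub>G\<^esub> \<phi> h' \<otimes>\<^bsub>G\<^esub> inv\<^bsub>G\<^esub> (\<phi> h)"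
      using G.inv_solve_right[of n "n' \<otimes>\<^bsub>G\<^esub> \<phi> h'" "\<phi> h"] eq assms(1-4) by simp
    then have "inv\<^bsub>G\<^esub> n' \<otimes>\<^bsub>G\<^esub> n = inv\<^bsub>G\<^esub> n' \<otimes>\<^bsub>G\<^esub> (n' \<otimes>\<^bsub>G\<^esub> \<phi> h' \<otimes>\<^bsub>G\<^esub> inv\<^bsub>G\<^esub> (\<phi> h))"
      by simp
    also have "\<dots> = \<phi> h' \<otimes>\<^bsub>G\<^esub> inv\<^bsub>G\<^esub> (\<phi> h)"
      using assms(1-4) by (simp add: G.m_assoc G.inv_solve_left')
    finally show ?thesis using assms by simp
  qed
  moreover have "inv\<^bsub>G\<^esub> n' \<otimes>\<^bsub>G\<^esub> n \<in> N"
    using subgroup_N assms by (simp add: subgroup.m_closed subgroup.m_inv_closed)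
  ultimately have "inv\<^bsub>G\<^esub> n' \<otimes>\<^bsub>G\<^esub> n \<in> N \<inter> \<phi> ` carrier H"
    using assms(2,4) by (metis IntI imageI H.m_closed H.inv_closed)
  then have "inv\<^bsub>G\<^esub> n' \<otimes>\<^bsub>G\<^esub> n = \<one>\<^bsub>G\<^esub>" using N_Int by auto
  then show n: "n = n'" using assms(1,3) G.inv_solve_left'[of "\<one>\<^bsub>G\<^esub>" n' n] by simp
  show "h = h'" using eq assms(1-4) phi_inj[of h h'] unfolding n by simp
qed

lemma card_set_mult:
  assumes "K \<subseteq> carrier H"
  shows "card (N <#>\<^bsub>G\<^esub> \<phi> ` K) = card N * card K"
proof -
  have "N <#>\<^bsub>G\<^esub> \<phi> ` K = (\<lambda>(n, k). n \<otimes>\<^bsub>G\<^esub> \<phi> k) ` (N \<times> K)"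
    unfolding set_mult_def by auto
  moreover have "inj_on (\<lambda>(n, k). n \<otimes>\<^bsub>G\<^esub> \<phi> k) (N \<times> K)"
  proof (rule inj_onI, clarify)
    fix n k n' k' assume "n \<in> N" "k \<in> K" "n' \<in> N" "k' \<in> K" "n \<otimes>\<^bsub>G\<^esub> \<phi> k = n' \<otimes>\<^bsub>G\<^esub> \<phi> k'"
    with assms show "n = n' \<and> k = k'"
      by (metis decomposition_unique subsetD)
  qed
  ultimately show ?thesis by (simp add: card_image card_cartesian_product)
qed

lemma M_subset: "M \<subseteq> carrier G"
  unfolding set_mult_def by auto

lemma finite_subset_G: "U \<subseteq> carrier G \<Longrightarrow> finite U"
  using finite_G finite_subset by blast

lemma subgroup_set_mult:
  assumes K: "subgroup K H"
  shows "subgroup (N <#>\<^bsub>G\<^esub> \<phi> ` K) G"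
proof (rule G.subgroupI)
  have KH: "K \<subseteq> carrier H" by (rule subgroup.subset[OF K])
  show "N <#>\<^bsub>G\<^esub> \<phi> ` K \<subseteq> carrier G" using KH unfolding set_mult_def by auto
  show "N <#>\<^bsub>G\<^esub> \<phi> ` K \<noteq> {}"
    using subgroup.one_closed[OF K] subgroup.one_closed[OF subgroup_N] unfolding set_mult_def by auto
  show "inv\<^bsub>G\<^esub> a \<in> N <#>\<^bsub>G\<^esub> \<phi> ` K" if a: "a \<in> N <#>\<^bsub>G\<^esub> \<phi> ` K" for a
  proof -
    obtain n k where nk: "n \<in> N" "k \<in> K" "a = n \<otimes>\<^bsub>G\<^esub> \<phi> k" using a unfolding set_mult_def by auto
    have k: "k \<in> carrier H" using nk KH by auto
    have "inv\<^bsub>G\<^esub> a = inv\<^bsub>G\<^esub> (\<phi> k \<otimes>\<^bsub>G\<^esub> n)" using nk k N_commute by simp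
    also have "\<dots> = inv\<^bsub>G\<^esub> n \<otimes>\<^bsub>G\<^esub> \<phi> (inv\<^bsub>H\<^esub> k)" using nk k by (simp add: G.inv_mult_group)
    finally show ?thesis
      using nk subgroup.m_inv_closed[OF K] subgroup.m_inv_closed[OF subgroup_N]
      unfolding set_mult_def by blast
  qed
  show "a \<otimes>\<^bsub>G\<^esub> b \<in> N <#>\<^bsub>G\<^esub> \<phi> ` K" if a: "a \<in> N <#>\<^bsub>G\<^esub> \<phi> ` K" and b: "b \<in> N <#>\<^bsub>G\<^esub> \<phi> ` K" for a b
  proof -
    obtain n k where nk: "n \<in> N" "k \<in> K" "a = n \<otimes>\<^bsub>G\<^esub> \<phi> k" using a unfolding set_mult_def by auto
    obtain m l where ml: "m \<in> N" "l \<in> K" "b = m \<otimes>\<^bsub>G\<^esub> \<phi> l" using b unfolding set_mult_def by auto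
    have "a \<otimes>\<^bsub>G\<^esub> b = (n \<otimes>\<^bsub>G\<^esub> m) \<otimes>\<^bsub>G\<^esub> \<phi> (k \<otimes>\<^bsub>H\<^esub> l)"
      unfolding nk(3) ml(3) using nk ml KH by (intro mult_swap) auto
    then show ?thesis
      using nk ml subgroup.m_closed[OF K] subgroup.m_closed[OF subgroup_N]
      unfolding set_mult_def by blast
  qed
qed

text \<open>As \<open>K\<close> contains the identity, NK contains \<open>N\<close>, so its
  centralizer lies in C(N) = \<open>M\<close>. There the abelian factor \<open>N\<close> imposes no
  condition and only the \<open>H\<close> components matter.\<close>

lemma centralizer_set_mult:
  assumes K: "K \<subseteq> carrier H" "\<one>\<^bsub>H\<^esub> \<in> K"
  shows "centralizer G (N <#>\<^bsub>G\<^esub> \<phi> ` K) = N <#>\<^bsub>G\<^esub> \<phi> ` centralizer H K"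
proof
  have NK: "N \<subseteq> N <#>\<^bsub>G\<^esub> \<phi> ` K" using K G.r_one phi_one by (force simp: set_mult_def)
  show "centralizer G (N <#>\<^bsub>G\<^esub> \<phi> ` K) \<subseteq> N <#>\<^bsub>G\<^esub> \<phi> ` centralizer H K"
  proof
    fix a assume a: "a \<in> centralizer G (N <#>\<^bsub>G\<^esub> \<phi> ` K)"
    then have "a \<in> M" using centralizer_antimono[OF NK] centralizer_N by auto
    then obtain n h where nh: "n \<in> N" "h \<in> carrier H" "a = n \<otimes>\<^bsub>G\<^esub> \<phi> h" unfolding set_mult_def by auto
    have "h \<otimes>\<^bsub>H\<^esub> k = k \<otimes>\<^bsub>H\<^esub> h" if k: "k \<in> K" for k
    proof -
      have kH: "k \<in> carrier H" using k K by auto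
      have "\<one>\<^bsub>G\<^esub> \<otimes>\<^bsub>G\<^esub> \<phi> k \<in> N <#>\<^bsub>G\<^esub> \<phi> ` K"
        using subgroup.one_closed[OF subgroup_N] k unfolding set_mult_def by blast
      then have "a \<otimes>\<^bsub>G\<^esub> (\<one>\<^bsub>G\<^esub> \<otimes>\<^bsub>G\<^esub> \<phi> k) = (\<one>\<^bsub>G\<^esub> \<otimes>\<^bsub>G\<^esub> \<phi> k) \<otimes>\<^bsub>G\<^esub> a"
        using a unfolding centralizer_def by auto
      then have "n \<otimes>\<^bsub>G\<^esub> \<one>\<^bsub>G\<^esub> \<otimes>\<^bsub>G\<^esub> \<phi> (h \<otimes>\<^bsub>H\<^esub> k) = \<one>\<^bsub>G\<^esub> \<otimes>\<^bsub>G\<^esub> n \<otimes>\<^bsub>G\<^esub> \<phi> (k \<otimes>\<^bsub>H\<^esub> h)"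
        unfolding nh(3) mult_swap[OF nh(1,2) subgroup.one_closed[OF subgroup_N] kH]
          mult_swap[OF subgroup.one_closed[OF subgroup_N] kH nh(1,2)] .
      then show ?thesis
        using decomposition_unique(2)[of n "h \<otimes>\<^bsub>H\<^esub> k" n "k \<otimes>\<^bsub>H\<^esub> h"] nh kH by simp
    qed
    then show "a \<in> N <#>\<^bsub>G\<^esub> \<phi> ` centralizer H K"
      using nh unfolding set_mult_def centralizer_def by blast
  qed
  show "N <#>\<^bsub>G\<^esub> \<phi> ` centralizer H K \<subseteq> centralizer G (N <#>\<^bsub>G\<^esub> \<phi> ` K)"
  proof
    fix a assume "a \<in> N <#>\<^bsub>G\<^esub> \<phi> ` centralizer H K"
    then obtain n h where nh: "n \<in> N" "h \<in> centralizer H K" "a = n \<otimes>\<^bsub>G\<^esub> \<phi> h" unfolding set_mult_def by auto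
    have h: "h \<in> carrier H" using nh by (auto simp: centralizer_def)
    have "a \<otimes>\<^bsub>G\<^esub> (m \<otimes>\<^bsub>G\<^esub> \<phi> k) = (m \<otimes>\<^bsub>G\<^esub> \<phi> k) \<otimes>\<^bsub>G\<^esub> a" if "m \<in> N" "k \<in> K" for m k
    proof -
      have k: "k \<in> carrier H" using that K by auto
      have "h \<otimes>\<^bsub>H\<^esub> k = k \<otimes>\<^bsub>H\<^esub> h" using nh(2) that by (auto simp: centralizer_def)
      then show ?thesis
        unfolding nh(3) mult_swap[OF nh(1) h that(1) k] mult_swap[OF that(1) k nh(1) h]
        using N_abelian[OF nh(1) that(1)] by simp
    qed
    then show "a \<in> centralizer G (N <#>\<^bsub>G\<^esub> \<phi> ` K)"
      using nh h unfolding centralizer_def set_mult_def by auto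
  qed
qed

section \<open>Measures of subgroups inside M\<close>

lemma CD_measure_set_mult:
  assumes "K \<subseteq> carrier H" "\<one>\<^bsub>H\<^esub> \<in> K"
  shows "CD_measure G (N <#>\<^bsub>G\<^esub> \<phi> ` K) = card N * card N * CD_measure H K"
proof -
  have "card (N <#>\<^bsub>G\<^esub> \<phi> ` centralizer H K) = card N * card (centralizer H K)"
    by (rule card_set_mult) (rule centralizer_subset)
  then show ?thesis
    using card_set_mult[OF assms(1)] centralizer_set_mult[OF assms]
    unfolding CD_measure_def by (metis mult.assoc mult.left_commute)
qed

lemma CD_max_H: "CD_max H = card (carrier H) * card (center H)"
  using H_in_CD unfolding CD_lattice_def CD_measure_def center_def by auto

text \<open>The image in \<open>H\<close> of the part of \<open>U\<close> inside \<open>M\<close>.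
  It makes sense for every \<open>U\<close>; containment in \<open>M\<close> is asked for only where
  \<open>U\<close> is to be covered by N times its projection.\<close>

definition proj where "proj U = {h \<in> carrier H. \<exists>n \<in> N. n \<otimes>\<^bsub>G\<^esub> \<phi> h \<in> U}"

lemma subgroup_proj:
  assumes U: "subgroup U G"
  shows "subgroup (proj U) H"
proof (rule H.subgroupI)
  show "proj U \<subseteq> carrier H" unfolding proj_def by auto
  have "\<one>\<^bsub>G\<^esub> \<otimes>\<^bsub>G\<^esub> \<phi> \<one>\<^bsub>H\<^esub> \<in> U" using subgroup.one_closed[OF U] by simp
  then have "\<one>\<^bsub>H\<^esub> \<in> proj U"
    using subgroup.one_closed[OF subgroup_N] unfolding proj_def by blast
  then show "proj U \<noteq> {}" by blast
  show "inv\<^bsub>H\<^esub> h \<in> proj U" if h: "h \<in> proj U" for h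
  proof -
    obtain n where n: "n \<in> N" "n \<otimes>\<^bsub>G\<^esub> \<phi> h \<in> U" "h \<in> carrier H" using h unfolding proj_def by auto
    have "inv\<^bsub>G\<^esub> (n \<otimes>\<^bsub>G\<^esub> \<phi> h) = inv\<^bsub>G\<^esub> (\<phi> h \<otimes>\<^bsub>G\<^esub> n)" using n N_commute by simp
    also have "\<dots> = inv\<^bsub>G\<^esub> n \<otimes>\<^bsub>G\<^esub> \<phi> (inv\<^bsub>H\<^esub> h)" using n by (simp add: G.inv_mult_group)
    finally show ?thesis
      using n subgroup.m_inv_closed[OF U n(2)] subgroup.m_inv_closed[OF subgroup_N n(1)]
      unfolding proj_def by auto
  qed
  show "h \<otimes>\<^bsub>H\<^esub> k \<in> proj U" if h: "h \<in> proj U" and k: "k \<in> proj U" for h k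
  proof -
    obtain n where n: "n \<in> N" "n \<otimes>\<^bsub>G\<^esub> \<phi> h \<in> U" "h \<in> carrier H" using h unfolding proj_def by auto
    obtain m where m: "m \<in> N" "m \<otimes>\<^bsub>G\<^esub> \<phi> k \<in> U" "k \<in> carrier H" using k unfolding proj_def by auto
    have "(n \<otimes>\<^bsub>G\<^esub> m) \<otimes>\<^bsub>G\<^esub> \<phi> (h \<otimes>\<^bsub>H\<^esub> k) \<in> U"
      using mult_swap n m subgroup.m_closed[OF U n(2) m(2)] by simp
    then show ?thesis
      using n m subgroup.m_closed[OF subgroup_N n(1) m(1)] unfolding proj_def by blast
  qed
qed

lemma subset_set_mult_proj:
  assumes "U \<subseteq> M"
  shows "U \<subseteq> N <#>\<^bsub>G\<^esub> \<phi> ` proj U"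
proof
  fix u assume u: "u \<in> U"
  then obtain n h where nh: "n \<in> N" "h \<in> carrier H" "u = n \<otimes>\<^bsub>G\<^esub> \<phi> h"
    using assms unfolding set_mult_def by auto
  then have "h \<in> proj U" using u unfolding proj_def by auto
  then show "u \<in> N <#>\<^bsub>G\<^esub> \<phi> ` proj U" using nh unfolding set_mult_def by auto
qed

text \<open>An element of C(U) commutes with some element of \<open>U\<close> over each
  \<open>h\<close> in the projection; comparing \<open>H\<close> components of the two products
  gives the condition on \<open>k\<close>.\<close>

lemma centralizer_subset_set_mult_proj:
  assumes "U \<subseteq> M" "centralizer G U \<subseteq> M"
  shows "centralizer G U \<subseteq> N <#>\<^bsub>G\<^esub> \<phi> ` centralizer H (proj U)"
proof
  fix a assume a: "a \<in> centralizer G U"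
  then obtain m k where mk: "m \<in> N" "k \<in> carrier H" "a = m \<otimes>\<^bsub>G\<^esub> \<phi> k"
    using assms(2) unfolding set_mult_def by auto
  have "k \<otimes>\<^bsub>H\<^esub> h = h \<otimes>\<^bsub>H\<^esub> k" if h: "h \<in> proj U" for h
  proof -
    obtain n where n: "n \<in> N" "n \<otimes>\<^bsub>G\<^esub> \<phi> h \<in> U" "h \<in> carrier H" using h unfolding proj_def by auto
    have "a \<otimes>\<^bsub>G\<^esub> (n \<otimes>\<^bsub>G\<^esub> \<phi> h) = (n \<otimes>\<^bsub>G\<^esub> \<phi> h) \<otimes>\<^bsub>G\<^esub> a"
      using a n unfolding centralizer_def by auto
    then have "(m \<otimes>\<^bsub>G\<^esub> n) \<otimes>\<^bsub>G\<^esub> \<phi> (k \<otimes>\<^bsub>H\<^esub> h) = (n \<otimes>\<^bsub>G\<^esub> m) \<otimes>\<^bsub>G\<^esub> \<phi> (h \<otimes>\<^bsub>H\<^esub> k)"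
      unfolding mk(3) mult_swap[OF mk(1,2) n(1,3)] mult_swap[OF n(1,3) mk(1,2)] .
    then show ?thesis
      using decomposition_unique(2)[of "m \<otimes>\<^bsub>G\<^esub> n" "k \<otimes>\<^bsub>H\<^esub> h" "n \<otimes>\<^bsub>G\<^esub> m" "h \<otimes>\<^bsub>H\<^esub> k"] mk n
        subgroup.m_closed[OF subgroup_N] by simp
  qed
  then show "a \<in> N <#>\<^bsub>G\<^esub> \<phi> ` centralizer H (proj U)"
    using mk unfolding set_mult_def centralizer_def by blast
qed

section \<open>Bounding the measure of an arbitrary subgroup\<close>

lemma card_pos:
  "0 < card N" "0 < card (carrier H)" "0 < card (carrier G)" "0 < card (center G)"
proof -
  have pos: "0 < card U" if "subgroup U G" for U
    using subgroup.one_closed[OF that] finite_subset_G[OF subgroup.subset[OF that]]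
    by (auto simp: card_gt_0_iff)
  show "0 < card N" by (rule pos[OF subgroup_N])
  show G0: "0 < card (carrier G)" by (rule pos[OF G.subgroup_self])
  show Z0: "0 < card (center G)" by (rule pos[OF G.subgroup_center])
  \<comment> \<open>By \<open>card_eq\<close> this positive number has |H| as a factor. Since
    \<open>card\<close> of an infinite set is 0, finiteness of \<open>H\<close> follows as
    well.\<close>
  have "0 < card (carrier G) * card (center G)" using G0 Z0 by simp
  then show "0 < card (carrier H)" unfolding card_eq by simp
qed

lemma finite_H: "finite (carrier H)"
  using card_pos(2) card_ge_0_finite by blast

text \<open>\<open>M\<close> is the centralizer of \<open>N\<close>, so equality would make
  \<open>N\<close> central.\<close>

lemma M_neq: "M \<noteq> carrier G"
proof
  assume "M = carrier G"
  then have "centralizer G N = carrier G" using centralizer_N by simp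
  then have "u \<in> centralizer G N" if "u \<in> carrier G" for u using that by simp
  then have "N \<subseteq> center G" unfolding center_def centralizer_def by auto
  then show False using N_not_central by simp
qed

text \<open>If \<open>U\<close> leaves \<open>M\<close> and \<open>C(U)\<close> is not central, then \<open>C(U)\<close> leaves \<open>M\<close> as well,
  so both have order at most \<open>p |Z(G)|\<close>.\<close>

lemma measure_outside:
  assumes U: "subgroup U G" and nM: "\<not> U \<subseteq> M"
  shows "CD_measure G U \<le> card (carrier G) * card (center G)"
    and "CD_measure G U = card (carrier G) * card (center G) \<Longrightarrow> U = carrier G"
proof -
  have UG: "U \<subseteq> carrier G" by (rule subgroup.subset[OF U])
  obtain u where u: "u \<in> U" "u \<in> carrier G" "u \<notin> M" using nM UG by auto
  have central: "CD_measure G U \<le> card (carrier G) * card (center G) \<and>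
      (CD_measure G U = card (carrier G) * card (center G) \<longrightarrow> U = carrier G)"
    if "centralizer G U \<subseteq> center G"
  proof -
    have "centralizer G U = center G" using that center_subset_centralizer[OF UG] by auto
    then have m: "CD_measure G U = card U * card (center G)" unfolding CD_measure_def by simp
    show ?thesis
      unfolding m using card_mono[OF finite_G UG] card_pos(4) card_subset_eq[OF finite_G UG] by simp
  qed
  have lt: "CD_measure G U < card (carrier G) * card (center G)" if nc: "\<not> centralizer G U \<subseteq> center G"
  proof -
    obtain w where w: "w \<in> centralizer G U" "w \<notin> center G" using nc by auto
    have CU: "centralizer G U \<subseteq> centralizer G {u}" using u by (intro centralizer_antimono) auto
    \<comment> \<open>Inside \<open>M\<close> the element \<open>w\<close> would lie in the
      intersection of C(u) and \<open>M\<close>, hence be central.\<close>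
    have wM: "w \<notin> M" using outside_Int[OF u(2,3)] w CU by auto
    have wG: "w \<in> carrier G" using subsetD[OF centralizer_subset w(1)] .
    have "U \<subseteq> centralizer G {w}"
      using subset_double_centralizer[OF UG] centralizer_antimono[of "{w}" "centralizer G U" G] w by auto
    then have "card U \<le> p * card (center G)"
      by (intro le_trans[OF card_mono outside_card[OF wG wM]] finite_subset_G centralizer_subset)
    moreover have "card (centralizer G U) \<le> p * card (center G)"
      by (intro le_trans[OF card_mono outside_card[OF u(2,3)]] finite_subset_G centralizer_subset CU)
    ultimately have "CD_measure G U \<le> (p * card (center G)) * (p * card (center G))"
      unfolding CD_measure_def by (rule mult_le_mono)
    \<comment> \<open>One factor |Z(G)| is split off so that \<open>center_small\<close> compares
      the rest with |G|.\<close>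
    also have "\<dots> = (p * p * card (center G)) * card (center G)" by simp
    also have "\<dots> < card (carrier G) * card (center G)"
      using center_small card_pos(4) by (meson mult_less_mono1)
    finally show ?thesis .
  qed
  show "CD_measure G U \<le> card (carrier G) * card (center G)"
    using lt central by linarith
  show "U = carrier G" if "CD_measure G U = card (carrier G) * card (center G)"
    using lt central that by linarith
qed

text \<open>An element \<open>w\<close> of C(U) outside \<open>M\<close> gives U <= C(w), and C(w)
  meets \<open>M\<close> only in central elements. So \<open>U\<close> is central and its measure is
  |U| |G|.\<close>

lemma measure_centralizer_outside:
  assumes U: "subgroup U G" and "U \<subseteq> M" "\<not> centralizer G U \<subseteq> M"
  shows "CD_measure G U \<le> card (carrier G) * card (center G)"
    and "CD_measure G U = card (carrier G) * card (center G) \<Longrightarrow> U = center G"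
proof -
  have UG: "U \<subseteq> carrier G" by (rule subgroup.subset[OF U])
  obtain w where w: "w \<in> centralizer G U" "w \<notin> M" "w \<in> carrier G"
    using assms(3) subsetD[OF centralizer_subset, of _ G U] by auto
  have "U \<subseteq> centralizer G {w}"
    using subset_double_centralizer[OF UG] centralizer_antimono[of "{w}" "centralizer G U" G] w by auto
  then have Uc: "U \<subseteq> center G" using outside_Int[OF w(3,2)] assms(2) by auto
  have fc: "finite (center G)" using finite_subset_G subgroup.subset[OF G.subgroup_center] by blast
  have m: "CD_measure G U = card U * card (carrier G)"
    unfolding CD_measure_def centralizer_of_subset_center[OF Uc] ..
  show "CD_measure G U \<le> card (carrier G) * card (center G)"
    unfolding m using card_mono[OF fc Uc] by simp
  show "U = center G" if "CD_measure G U = card (carrier G) * card (center G)"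
    using that card_pos(3) card_subset_eq[OF fc Uc] unfolding m by simp
qed

text \<open>With K the projection of U, m(U) <= |U| |N| |C_H(K)| <= |N|^2 m_H(K) <= |N|^2 m(H) = |G|
  |Z(G)|. Equality of the ends forces equality throughout: the last inequality puts K into the
  lattice of H, the second gives |U| = |N| |K| and thus U = NK.\<close>

lemma measure_inside:
  assumes U: "subgroup U G" and UM: "U \<subseteq> M" "centralizer G U \<subseteq> M"
  shows "CD_measure G U \<le> card (carrier G) * card (center G)"
    and "CD_measure G U = card (carrier G) * card (center G)
      \<Longrightarrow> \<exists>K. K \<in> CD_lattice H \<and> U = N <#>\<^bsub>G\<^esub> \<phi> ` K"
proof -
  let ?K = "proj U"
  have K: "subgroup ?K H" by (rule subgroup_proj[OF U])
  have KH: "?K \<subseteq> carrier H" by (rule subgroup.subset[OF K])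
  have fin: "finite (N <#>\<^bsub>G\<^esub> \<phi> ` L)" if "L \<subseteq> carrier H" for L
    using that by (intro finite_subset_G) (auto simp: set_mult_def)
  have a: "card U \<le> card N * card ?K"
    using card_mono[OF fin[OF KH] subset_set_mult_proj[OF UM(1)]] card_set_mult[OF KH] by simp
  have b: "card (centralizer G U) \<le> card N * card (centralizer H ?K)"
    using card_mono[OF fin[OF centralizer_subset] centralizer_subset_set_mult_proj[OF UM]]
      card_set_mult[OF centralizer_subset] by simp
  have ab: "CD_measure G U \<le> card U * (card N * card (centralizer H ?K))"
    unfolding CD_measure_def using b by simp
  have c: "card U * (card N * card (centralizer H ?K)) \<le> card N * card N * CD_measure H ?K"
    using mult_le_mono1[OF a, of "card N * card (centralizer H ?K)"]
    unfolding CD_measure_def by (simp add: mult_ac)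
  have d: "card N * card N * CD_measure H ?K \<le> card (carrier G) * card (center G)"
    unfolding card_eq using H.CD_measure_le_CD_max[OF finite_H K] CD_max_H by simp
  show "CD_measure G U \<le> card (carrier G) * card (center G)" using ab c d by linarith
  assume eq: "CD_measure G U = card (carrier G) * card (center G)"
  have "card N * card N * CD_measure H ?K = card N * card N * CD_max H"
    using ab c d eq unfolding card_eq CD_max_H by linarith
  then have m: "CD_measure H ?K = CD_max H" using card_pos(1) by simp
  have "card U * (card N * card (centralizer H ?K)) = card N * card N * CD_measure H ?K"
    using ab c d eq by linarith
  then have "card U * (card N * card (centralizer H ?K)) = card N * card ?K * (card N * card (centralizer H ?K))"
    unfolding CD_measure_def by (simp only: mult_ac)
  moreover have "0 < card N * card (centralizer H ?K)"
    using subgroup.one_closed[OF H.subgroup_centralizer[OF KH]] card_pos(1)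
      finite_subset[OF centralizer_subset finite_H, of ?K] by (auto simp: card_gt_0_iff)
  ultimately have "card U = card (N <#>\<^bsub>G\<^esub> \<phi> ` ?K)"
    unfolding card_set_mult[OF KH] by simp
  then have "U = N <#>\<^bsub>G\<^esub> \<phi> ` ?K"
    using card_subset_eq[OF fin[OF KH] subset_set_mult_proj[OF UM(1)]] by simp
  then show "\<exists>K. K \<in> CD_lattice H \<and> U = N <#>\<^bsub>G\<^esub> \<phi> ` K"
    using K m unfolding CD_lattice_def by blast
qed

section \<open>The maximal measure and the lattice of G\<close>

lemma CD_max_G: "CD_max G = card (carrier G) * card (center G)"
proof (rule G.CD_max_eqI[OF finite_G G.subgroup_self])
  show "CD_measure G (carrier G) = card (carrier G) * card (center G)"
    unfolding CD_measure_def center_def ..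
  show "CD_measure G V \<le> card (carrier G) * card (center G)" if V: "subgroup V G" for V
    \<comment> \<open>The three bounds exhaust all cases: V leaves \<open>M\<close>, only C(V)
      leaves \<open>M\<close>, or both stay inside.\<close>
    using measure_outside(1)[OF V] measure_centralizer_outside(1)[OF V] measure_inside(1)[OF V]
    by argo
qed

theorem CD_lattice_G:
  "CD_lattice G = {carrier G, center G} \<union> {N <#>\<^bsub>G\<^esub> \<phi> ` K | K. K \<in> CD_lattice H}"
proof (intro equalityI subsetI)
  fix U assume "U \<in> CD_lattice G"
  then have U: "subgroup U G" and m: "CD_measure G U = card (carrier G) * card (center G)"
    unfolding CD_lattice_def CD_max_G by auto
  have "U = carrier G \<or> U = center G \<or> (\<exists>K. K \<in> CD_lattice H \<and> U = N <#>\<^bsub>G\<^esub> \<phi> ` K)"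
    using measure_outside(2)[OF U _ m] measure_centralizer_outside(2)[OF U _ _ m]
      measure_inside(2)[OF U _ _ m] by argo
  then show "U \<in> {carrier G, center G} \<union> {N <#>\<^bsub>G\<^esub> \<phi> ` K | K. K \<in> CD_lattice H}"
    by blast
next
  fix U assume "U \<in> {carrier G, center G} \<union> {N <#>\<^bsub>G\<^esub> \<phi> ` K | K. K \<in> CD_lattice H}"
  then consider "U = carrier G" | "U = center G"
    | K where "K \<in> CD_lattice H" "U = N <#>\<^bsub>G\<^esub> \<phi> ` K" by blast
  then show "U \<in> CD_lattice G"
  proof cases
    case 1
    then show ?thesis
      unfolding CD_lattice_def CD_max_G CD_measure_def using G.subgroup_self by (simp add: center_def)
  next
    case 2
    then show ?thesis
      unfolding CD_lattice_def CD_max_G CD_measure_def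
      using G.subgroup_center G.centralizer_center by simp
  next
    case 3
    then have K: "subgroup K H" "CD_measure H K = CD_max H" unfolding CD_lattice_def by auto
    then show ?thesis
      unfolding CD_lattice_def CD_max_G 3(2)
      using CD_measure_set_mult[OF subgroup.subset[OF K(1)] subgroup.one_closed[OF K(1)]]
        subgroup_set_mult[OF K(1)] card_eq CD_max_H by simp
  qed
qed

lemma M_psubset: "M \<subset> carrier G"
  using M_subset M_neq by auto

text \<open>Z(G) centralizes \<open>M\<close>, and C(M) = N Z(H). The containment is proper because
  N Z(H) contains \<open>N\<close>, which is not central.\<close>

lemma center_psubset: "center G \<subset> N <#>\<^bsub>G\<^esub> \<phi> ` center H"
proof -
  have "center G \<subseteq> centralizer G M" by (rule center_subset_centralizer[OF M_subset])
  also have "\<dots> = N <#>\<^bsub>G\<^esub> \<phi> ` center H"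
    using centralizer_set_mult[of "carrier H"] unfolding center_def by simp
  finally have "center G \<subseteq> N <#>\<^bsub>G\<^esub> \<phi> ` center H" .
  moreover have "N \<subseteq> N <#>\<^bsub>G\<^esub> \<phi> ` center H"
    using subgroup.one_closed[OF H.subgroup_center] G.r_one phi_one by (force simp: set_mult_def)
  ultimately show ?thesis using N_not_central by blast
qed

end

section \<open>Groups of exponent p\<close>

abbreviation Zmod where "Zmod \<equiv> integer_mod_group"

text \<open>The exponent only has to divide \<open>p\<close>, so the trivial group
  qualifies.\<close>

definition has_exponent :: "('a, 'b) monoid_scheme \<Rightarrow> nat \<Rightarrow> bool" where
  "has_exponent G p \<longleftrightarrow> (\<forall>x \<in> carrier G. x [^]\<^bsub>G\<^esub> p = \<one>\<^bsub>G\<^esub>)"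

text \<open>Makes powers by residues mod \<open>p\<close> well defined: the order of
  \<open>x\<close> divides \<open>p\<close>, which divides the difference of the two
  exponents.\<close>

lemma (in group) int_pow_mod_exponent:
  assumes "has_exponent G p" "x \<in> carrier G"
  shows "x [^] (a mod int p) = x [^] a"
proof -
  have "int (ord x) dvd int p"
    using assms unfolding has_exponent_def by (simp add: pow_eq_id)
  then show ?thesis
    using dvd_trans[OF _ dvd_minus_mod, of "int (ord x)" "int p" a] assms(2) by (simp add: int_pow_eq)
qed

text \<open>The order of \<open>x\<close> is 1 or \<open>p\<close>, and \<open>p\<close> divides no
  integer strictly between 0 and \<open>p\<close>.\<close>

lemma (in group) int_pow_eq_one_prime_exponent:
  assumes "has_exponent G p" "Factorial_Ring.prime p" "x \<in> carrier G"
    and "0 < a" "a < int p" "x [^] a = \<one>"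
  shows "x = \<one>"
proof -
  have "ord x dvd p"
    using assms unfolding has_exponent_def by (simp add: pow_eq_id)
  then consider "ord x = 1" | "ord x = p" using assms(2) by (auto simp: prime_nat_iff)
  then show ?thesis
  proof cases
    case 1 then show ?thesis using assms ord_eq_1 by blast
  next
    case 2
    have "int p dvd a" using assms(6) 2 int_pow_eq_id[OF assms(3), of a] by simp
    then show ?thesis using zdvd_imp_le[of "int p" a] assms(4,5) by simp
  qed
qed

lemma DirProd_comm_group:
  assumes "comm_group G" "comm_group K"
  shows "comm_group (G \<times>\<times> K)"
proof -
  interpret G: comm_group G by fact
  interpret K: comm_group K by fact
  interpret GK: group "G \<times>\<times> K" by (rule DirProd_group) unfold_locales
  show ?thesis
    by (rule GK.group_comm_groupI) (auto simp: G.m_comm K.m_comm)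
qed

text \<open>The two projections are homomorphisms, so they commute with integer powers.\<close>

lemma DirProd_int_pow:
  assumes "group G" "group K" "x \<in> carrier G" "y \<in> carrier K"
  shows "(x, y) [^]\<^bsub>G \<times>\<times> K\<^esub> (n::int) = (x [^]\<^bsub>G\<^esub> n, y [^]\<^bsub>K\<^esub> n)"
proof -
  have grp: "group (G \<times>\<times> K)" using assms by (simp add: DirProd_group)
  have "fst \<in> hom (G \<times>\<times> K) G" "snd \<in> hom (G \<times>\<times> K) K"
    by (auto simp: hom_def)
  then have "fst ((x, y) [^]\<^bsub>G \<times>\<times> K\<^esub> n) = x [^]\<^bsub>G\<^esub> n"
    "snd ((x, y) [^]\<^bsub>G \<times>\<times> K\<^esub> n) = y [^]\<^bsub>K\<^esub> n"
    using assms grp hom_int_pow[of fst "G \<times>\<times> K" G "(x, y)" n] hom_int_pow[of snd "G \<times>\<times> K" K "(x, y)" n]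
    by auto
  then show ?thesis by (metis prod.collapse)
qed

lemma DirProd_nat_pow:
  "(x, y) [^]\<^bsub>G \<times>\<times> K\<^esub> (n::nat) = (x [^]\<^bsub>G\<^esub> n, y [^]\<^bsub>K\<^esub> n)"
  by (induction n) auto

lemma DirProd_has_exponent:
  assumes "has_exponent G p" "has_exponent K p"
  shows "has_exponent (G \<times>\<times> K) p"
  using assms unfolding has_exponent_def by (auto simp: DirProd_nat_pow)

lemma Zmod_has_exponent: "has_exponent (Zmod p) p"
  unfolding has_exponent_def by simp

section \<open>A twisted central extension\<close>

text \<open>Under the assumptions of \<open>twisting\<close> below, this is the central extension of
  L x Z/p by R with the bilinear 2-cocycle \<open>\<eta> l [^] a'\<close>. The cocycle is not
  symmetrized: for commuting l and l' the commutator has R coordinate \<open>\<eta> l [^] a'\<close>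
  divided by \<open>\<eta> l' [^] a\<close>.\<close>

definition twist ::
  "nat \<Rightarrow> ('l, 'c) monoid_scheme \<Rightarrow> ('r, 'd) monoid_scheme \<Rightarrow> ('l \<Rightarrow> 'r) \<Rightarrow> ('l \<times> int \<times> 'r) monoid"
where
  "twist p L R \<eta> = \<lparr>carrier = carrier L \<times> carrier (Zmod p) \<times> carrier R,
     monoid.mult = (\<lambda>(l, a, r) (l', a', r').
       (l \<otimes>\<^bsub>L\<^esub> l', (a + a') mod int p, r \<otimes>\<^bsub>R\<^esub> r' \<otimes>\<^bsub>R\<^esub> \<eta> l [^]\<^bsub>R\<^esub> a')),
     monoid.one = (\<one>\<^bsub>L\<^esub>, 0, \<one>\<^bsub>R\<^esub>)\<rparr>"

lemma carrier_twist [simp]: "carrier (twist p L R \<eta>) = carrier L \<times> carrier (Zmod p) \<times> carrier R"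
  by (simp add: twist_def)

lemma one_twist [simp]: "\<one>\<^bsub>twist p L R \<eta>\<^esub> = (\<one>\<^bsub>L\<^esub>, 0, \<one>\<^bsub>R\<^esub>)"
  by (simp add: twist_def)

lemma mult_twist [simp]:
  "(l, a, r) \<otimes>\<^bsub>twist p L R \<eta>\<^esub> (l', a', r') =
     (l \<otimes>\<^bsub>L\<^esub> l', (a + a') mod int p, r \<otimes>\<^bsub>R\<^esub> r' \<otimes>\<^bsub>R\<^esub> \<eta> l [^]\<^bsub>R\<^esub> a')"
  by (simp add: twist_def)

text \<open>Forgets the central coordinate; the next twist is formed along this map.\<close>

definition twist_hom :: "('l \<Rightarrow> 'r) \<Rightarrow> 'l \<times> int \<times> 'r \<Rightarrow> 'r \<times> int" where
  "twist_hom \<eta> = (\<lambda>(l, a, r). (\<eta> l, a))"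

lemma twist_hom_simp [simp]: "twist_hom \<eta> (l, a, r) = (\<eta> l, a)"
  by (simp add: twist_hom_def)

locale twisting = L: group L + R: comm_group R
  for L and R +
  fixes \<eta> and p :: nat
  assumes hom: "\<eta> \<in> hom L R"
    and prime: "Factorial_Ring.prime p"
    and exponent: "has_exponent R p"
begin

lemma eta_closed [simp]: "l \<in> carrier L \<Longrightarrow> \<eta> l \<in> carrier R"
  using hom unfolding hom_def by auto

lemma eta_mult [simp]:
  "\<lbrakk>l \<in> carrier L; l' \<in> carrier L\<rbrakk> \<Longrightarrow> \<eta> (l \<otimes>\<^bsub>L\<^esub> l') = \<eta> l \<otimes>\<^bsub>R\<^esub> \<eta> l'"
  using hom unfolding hom_def by auto

lemma group_hom_eta: "group_hom L R \<eta>"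
  using hom by unfold_locales

lemmas eta_one [simp] = group_hom.hom_one[OF group_hom_eta]
lemmas eta_inv [simp] = group_hom.hom_inv[OF group_hom_eta]

lemma p_pos: "0 < p" using prime prime_gt_0_nat by blast

lemma carrier_Zmod: "carrier (Zmod p) = {0..<int p}"
  using p_pos by (simp add: carrier_integer_mod_group)

lemma mod_closed [simp]: "a mod int p \<in> carrier (Zmod p)"
  unfolding carrier_Zmod using p_pos by simp

lemma pow_mod [simp]: "r \<in> carrier R \<Longrightarrow> r [^]\<^bsub>R\<^esub> (a mod int p) = r [^]\<^bsub>R\<^esub> a"
  by (rule R.int_pow_mod_exponent[OF exponent])

lemma group_twist: "group (twist p L R \<eta>)"
proof (rule groupI)
  fix x y assume "x \<in> carrier (twist p L R \<eta>)" "y \<in> carrier (twist p L R \<eta>)"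
  then show "x \<otimes>\<^bsub>twist p L R \<eta>\<^esub> y \<in> carrier (twist p L R \<eta>)" by auto
next
  show "\<one>\<^bsub>twist p L R \<eta>\<^esub> \<in> carrier (twist p L R \<eta>)" by simp
next
  fix x y z
  assume "x \<in> carrier (twist p L R \<eta>)" "y \<in> carrier (twist p L R \<eta>)" "z \<in> carrier (twist p L R \<eta>)"
  \<comment> \<open>Bilinearity of the cocycle produces the same three cocycle values on both sides;
    \<open>pow_mod\<close> absorbs the reduction of exponents.\<close>
  then show "x \<otimes>\<^bsub>twist p L R \<eta>\<^esub> y \<otimes>\<^bsub>twist p L R \<eta>\<^esub> z
      = x \<otimes>\<^bsub>twist p L R \<eta>\<^esub> (y \<otimes>\<^bsub>twist p L R \<eta>\<^esub> z)"
    by (auto simp: L.m_assoc mod_simps add.assoc R.int_pow_distrib R.m_ac R.int_pow_mult)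
next
  fix x assume "x \<in> carrier (twist p L R \<eta>)"
  then show "\<one>\<^bsub>twist p L R \<eta>\<^esub> \<otimes>\<^bsub>twist p L R \<eta>\<^esub> x = x"
    by (auto simp: carrier_Zmod)
next
  fix x assume "x \<in> carrier (twist p L R \<eta>)"
  then obtain l a r where x: "x = (l, a, r)" "l \<in> carrier L" "a \<in> carrier (Zmod p)" "r \<in> carrier R"
    by auto
  \<comment> \<open>The last coordinate is chosen to cancel both \<open>r\<close> and the cocycle
    value of the inverse of \<open>l\<close> at \<open>a\<close>.\<close>
  let ?y = "(inv\<^bsub>L\<^esub> l, (- a) mod int p, inv\<^bsub>R\<^esub> (r \<otimes>\<^bsub>R\<^esub> \<eta> (inv\<^bsub>L\<^esub> l) [^]\<^bsub>R\<^esub> a))"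
  have "?y \<otimes>\<^bsub>twist p L R \<eta>\<^esub> x = \<one>\<^bsub>twist p L R \<eta>\<^esub>"
    using x by (simp add: mod_simps R.m_assoc)
  then show "\<exists>y \<in> carrier (twist p L R \<eta>). y \<otimes>\<^bsub>twist p L R \<eta>\<^esub> x = \<one>\<^bsub>twist p L R \<eta>\<^esub>"
    using x by (intro bexI[of _ ?y]) auto
qed

text \<open>\<open>R\<close> is commutative, so in the last coordinate only the two cocycle values
  can differ.\<close>

lemma twist_commute_iff:
  assumes "l \<in> carrier L" "a \<in> carrier (Zmod p)" "r \<in> carrier R"
    and "l' \<in> carrier L" "a' \<in> carrier (Zmod p)" "r' \<in> carrier R"
  shows "(l, a, r) \<otimes>\<^bsub>twist p L R \<eta>\<^esub> (l', a', r') = (l', a', r') \<otimes>\<^bsub>twist p L R \<eta>\<^esub> (l, a, r)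
    \<longleftrightarrow> l \<otimes>\<^bsub>L\<^esub> l' = l' \<otimes>\<^bsub>L\<^esub> l \<and> \<eta> l [^]\<^bsub>R\<^esub> a' = \<eta> l' [^]\<^bsub>R\<^esub> a"
proof -
  have "r' \<otimes>\<^bsub>R\<^esub> r \<otimes>\<^bsub>R\<^esub> \<eta> l' [^]\<^bsub>R\<^esub> a = r \<otimes>\<^bsub>R\<^esub> r' \<otimes>\<^bsub>R\<^esub> \<eta> l' [^]\<^bsub>R\<^esub> a"
    using assms by (simp add: R.m_comm)
  then show ?thesis using assms by (simp add: add.commute)
qed

lemma twist_hom_in_hom: "twist_hom \<eta> \<in> hom (twist p L R \<eta>) (R \<times>\<times> Zmod p)"
  by (auto simp: hom_def)

lemma twist_nat_pow:
  assumes "l \<in> carrier L" "r \<in> carrier R"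
  shows "(l, 0, r) [^]\<^bsub>twist p L R \<eta>\<^esub> (n::nat) = (l [^]\<^bsub>L\<^esub> n, 0, r [^]\<^bsub>R\<^esub> n)"
  using assms by (induction n) auto

text \<open>Allows a second round of twisting, along \<open>twist_hom\<close>, to reuse all results
  of this locale.\<close>

lemma twisting_twist: "twisting (twist p L R \<eta>) (R \<times>\<times> Zmod p) (twist_hom \<eta>) p"
proof -
  interpret T: group "twist p L R \<eta>" by (rule group_twist)
  interpret C: comm_group "R \<times>\<times> Zmod p"
    by (rule DirProd_comm_group) (auto intro: R.comm_group_axioms)
  show ?thesis
    by unfold_locales (auto simp: prime twist_hom_in_hom DirProd_has_exponent exponent Zmod_has_exponent)
qed

end

text \<open>\<open>A\<close> is the union of the p fibres of \<open>\<chi>\<close>. Right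
  translation by the inverse of one member injects a nonempty fibre into \<open>Z\<close>.\<close>

lemma (in group) card_le_kernel:
  assumes A: "subgroup A G" "finite A" and \<chi>: "\<chi> \<in> hom G (Zmod p)" and "0 < p"
    and Z: "finite Z" "\<And>x. \<lbrakk>x \<in> A; \<chi> x = 0\<rbrakk> \<Longrightarrow> x \<in> Z"
  shows "card A \<le> p * card Z"
proof -
  interpret \<chi>: group_hom G "Zmod p" \<chi>
    using \<chi> by (simp add: group_hom_def group_hom_axioms_def group_axioms)
  have AG: "A \<subseteq> carrier G" by (rule subgroup.subset[OF A(1)])
  have fib: "card {x \<in> A. \<chi> x = c} \<le> card Z" for c
  proof (cases "{x \<in> A. \<chi> x = c} = {}")
    case False
    then obtain y where y: "y \<in> A" "\<chi> y = c" by auto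
    have yG: "y \<in> carrier G" using y AG by auto
    show ?thesis
    proof (rule card_inj_on_le[of "\<lambda>x. x \<otimes> inv y"])
      show "inj_on (\<lambda>x. x \<otimes> inv y) {x \<in> A. \<chi> x = c}"
      proof (rule inj_onI)
        fix x x' assume "x \<in> {x \<in> A. \<chi> x = c}" "x' \<in> {x \<in> A. \<chi> x = c}" and eq: "x \<otimes> inv y = x' \<otimes> inv y"
        then have "x \<in> carrier G" "x' \<in> carrier G" using AG by auto
        then show "x = x'" using eq yG by simp
      qed
      show "(\<lambda>x. x \<otimes> inv y) ` {x \<in> A. \<chi> x = c} \<subseteq> Z"
      proof clarify
        fix x assume x: "x \<in> A" "c = \<chi> x"
        have xG: "x \<in> carrier G" using x AG by auto
        have "\<chi> (x \<otimes> inv y) = \<chi> x \<otimes>\<^bsub>Zmod p\<^esub> inv\<^bsub>Zmod p\<^esub> \<chi> x"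
          using xG yG y x by simp
        also have "\<dots> = 0"
          using group.r_inv[OF group_integer_mod_group \<chi>.hom_closed[OF xG]] by simp
        finally show "x \<otimes> inv y \<in> Z"
          using Z(2) x y subgroup.m_closed[OF A(1)] subgroup.m_inv_closed[OF A(1)] by simp
      qed
    qed (rule Z(1))
  next
    case True
    then show ?thesis by (metis card.empty zero_le)
  qed
  have "A = (\<Union>c \<in> {0..<int p}. {x \<in> A. \<chi> x = c})"
  proof -
    have "\<chi> x \<in> {0..<int p}" if "x \<in> A" for x
      using \<chi>.hom_closed[OF subsetD[OF AG that]] \<open>0 < p\<close> by (simp add: carrier_integer_mod_group)
    then show ?thesis by auto
  qed
  then have "card A \<le> (\<Sum>c \<in> {0..<int p}. card {x \<in> A. \<chi> x = c})"
    using card_UN_le[of "{0..<int p}" "\<lambda>c. {x \<in> A. \<chi> x = c}"] by simp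
  also have "\<dots> \<le> (\<Sum>c \<in> {0..<int p}. card Z)" by (rule sum_mono[OF fib])
  finally show ?thesis by simp
qed

section \<open>Iterating the extension\<close>

text \<open>An element killed by \<open>\<eta>\<close> is invisible to the twists;
  \<open>kernel_central\<close> makes it commute with \<open>L\<close> too, so the center of the
  double twist can be read off from \<open>\<eta>\<close> and the two twisting coordinates.\<close>

locale double_twisting = twisting +
  assumes finite_L: "finite (carrier L)" and finite_R: "finite (carrier R)"
    and kernel_central: "\<lbrakk>l \<in> carrier L; \<eta> l = \<one>\<^bsub>R\<^esub>\<rbrakk> \<Longrightarrow> l \<in> center L"
begin

abbreviation R2 where "R2 \<equiv> R \<times>\<times> Zmod p"

text \<open>Elements of \<open>E\<close> are \<open>((l, a\<^sub>1, r\<^sub>1), a\<^sub>2, (r\<^sub>2, c))\<close>. The second twist uses \<open>(l, a\<^sub>1) \<mapsto> (\<eta> l, a\<^sub>1)\<close>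
  instead of \<open>\<eta>\<close>; this is what makes \<open>c\<close> record the determinant.\<close>

definition E where "E = twist p (twist p L R \<eta>) R2 (twist_hom \<eta>)"

text \<open>Z(E) is the kernel of this map (\<open>center_E_iff\<close>), so E/Z(E) inherits
  commutativity and exponent from its target.\<close>

definition \<theta> where "\<theta> = twist_hom (twist_hom \<eta>)"

lemma theta_simp [simp]: "\<theta> ((l, a, r), b, s) = ((\<eta> l, a), b)"
  by (simp add: \<theta>_def)

lemma group_E: "group E"
  unfolding E_def by (rule twisting.group_twist[OF twisting_twist])

lemma theta_hom: "\<theta> \<in> hom E (R2 \<times>\<times> Zmod p)"
  unfolding E_def \<theta>_def by (rule twisting.twist_hom_in_hom[OF twisting_twist])

lemma comm_group_theta: "comm_group (R2 \<times>\<times> Zmod p)"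
  by (intro DirProd_comm_group R.comm_group_axioms abelian_integer_mod_group)

lemma exponent_theta: "has_exponent (R2 \<times>\<times> Zmod p) p"
  by (intro DirProd_has_exponent exponent Zmod_has_exponent)

lemma carrier_E: "carrier E = (carrier L \<times> {0..<int p} \<times> carrier R) \<times> {0..<int p} \<times> carrier R \<times> {0..<int p}"
  by (simp add: E_def carrier_Zmod)

lemma E_cases:
  assumes "x \<in> carrier E"
  obtains l a r b s where "x = ((l, a, r), b, s)" "l \<in> carrier L" "a \<in> {0..<int p}" "r \<in> carrier R"
    "b \<in> {0..<int p}" "s \<in> carrier R2"
  using assms unfolding E_def carrier_twist carrier_Zmod by (elim SigmaE) simp

lemma finite_E: "finite (carrier E)"
  unfolding carrier_E by (intro finite_cartesian_product finite_L finite_R) auto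

lemma card_E: "card (carrier E) = card (carrier L) * card (carrier R) * card (carrier R) * p ^ 3"
  unfolding carrier_E by (simp add: card_cartesian_product power3_eq_cube)

text \<open>The second twist takes powers in R x Z/p, so its condition splits into one in
  \<open>R\<close> and one in Z/p. The latter says that the determinant of (a, b) and (a', b')
  vanishes mod \<open>p\<close>.\<close>

lemma commute_iff:
  assumes "l \<in> carrier L" "a \<in> {0..<int p}" "r \<in> carrier R" "b \<in> {0..<int p}" "s \<in> carrier R2"
    and "l' \<in> carrier L" "a' \<in> {0..<int p}" "r' \<in> carrier R" "b' \<in> {0..<int p}" "s' \<in> carrier R2"
  shows "((l, a, r), b, s) \<otimes>\<^bsub>E\<^esub> ((l', a', r'), b', s') = ((l', a', r'), b', s') \<otimes>\<^bsub>E\<^esub> ((l, a, r), b, s)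
    \<longleftrightarrow> l \<otimes>\<^bsub>L\<^esub> l' = l' \<otimes>\<^bsub>L\<^esub> l \<and> \<eta> l [^]\<^bsub>R\<^esub> a' = \<eta> l' [^]\<^bsub>R\<^esub> a
      \<and> \<eta> l [^]\<^bsub>R\<^esub> b' = \<eta> l' [^]\<^bsub>R\<^esub> b \<and> (b' * a) mod int p = (b * a') mod int p"
proof -
  have C: "carrier (twist p L R \<eta>) = carrier L \<times> {0..<int p} \<times> carrier R"
    by (simp add: carrier_Zmod)
  have pow: "twist_hom \<eta> (l, a, r) [^]\<^bsub>R2\<^esub> n = (\<eta> l [^]\<^bsub>R\<^esub> n, (n * a) mod int p)"
    if "l \<in> carrier L" "a \<in> {0..<int p}" for l a r and n :: int
    using that by (simp add: DirProd_int_pow carrier_Zmod int_pow_integer_mod_group R.group_axioms)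
  show ?thesis
    unfolding E_def
    using assms twisting.twist_commute_iff[OF twisting_twist, of "(l, a, r)" b s "(l', a', r')" b' s']
    by (simp add: twist_commute_iff carrier_Zmod pow del: mult_twist twist_hom_simp)
qed

section \<open>The center of E\<close>

lemma kernel_central': "\<lbrakk>l \<in> carrier L; \<eta> l = \<one>\<^bsub>R\<^esub>; l' \<in> carrier L\<rbrakk> \<Longrightarrow> l \<otimes>\<^bsub>L\<^esub> l' = l' \<otimes>\<^bsub>L\<^esub> l"
  using kernel_central unfolding center_def centralizer_def by auto

lemma center_E:
  "center E = ({l \<in> carrier L. \<eta> l = \<one>\<^bsub>R\<^esub>} \<times> {0} \<times> carrier R) \<times> {0} \<times> carrier R2"
proof
  show "center E \<subseteq> ({l \<in> carrier L. \<eta> l = \<one>\<^bsub>R\<^esub>} \<times> {0} \<times> carrier R) \<times> {0} \<times> carrier R2"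
  proof
    fix x assume x: "x \<in> center E"
    then have "x \<in> carrier E" unfolding center_def centralizer_def by auto
    then obtain l a r b s where x_eq: "x = ((l, a, r), b, s)" and
      m: "l \<in> carrier L" "a \<in> {0..<int p}" "r \<in> carrier R" "b \<in> {0..<int p}" "s \<in> carrier R2"
      by (rule E_cases)
    have comm: "x \<otimes>\<^bsub>E\<^esub> y = y \<otimes>\<^bsub>E\<^esub> x" if "y \<in> carrier E" for y
      using x that unfolding center_def centralizer_def by auto
    have p1: "1 \<in> {0..<int p}" "0 \<in> {0..<int p}" using prime_gt_1_nat[OF prime] by auto
    have s1: "\<one>\<^bsub>R2\<^esub> \<in> carrier R2" by simp
    \<comment> \<open>Two test elements with trivial \<open>L\<close> coordinate and unit vectors as
      twisting coordinates: the first yields \<open>\<eta> l = \<one>\<close> and a = 0, the second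
      b = 0.\<close>
    have "((\<one>\<^bsub>L\<^esub>, 0, \<one>\<^bsub>R\<^esub>), 1, \<one>\<^bsub>R2\<^esub>) \<in> carrier E" "((\<one>\<^bsub>L\<^esub>, 1, \<one>\<^bsub>R\<^esub>), 0, \<one>\<^bsub>R2\<^esub>) \<in> carrier E"
      unfolding carrier_E using p1 by auto
    note c = this[THEN comm, unfolded x_eq]
    have "\<eta> l [^]\<^bsub>R\<^esub> (1::int) = \<one>\<^bsub>R\<^esub> [^]\<^bsub>R\<^esub> b" "(1 * a) mod int p = (b * 0) mod int p"
      using c(1) commute_iff[OF m L.one_closed p1(2) R.one_closed p1(1) s1] by auto
    moreover have "(0 * a) mod int p = (b * 1) mod int p"
      using c(2) commute_iff[OF m L.one_closed p1(1) R.one_closed p1(2) s1] by simp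
    ultimately show "x \<in> ({l \<in> carrier L. \<eta> l = \<one>\<^bsub>R\<^esub>} \<times> {0} \<times> carrier R) \<times> {0} \<times> carrier R2"
      unfolding x_eq using m by simp
  qed
  show "({l \<in> carrier L. \<eta> l = \<one>\<^bsub>R\<^esub>} \<times> {0} \<times> carrier R) \<times> {0} \<times> carrier R2 \<subseteq> center E"
  proof
    fix x :: "('a \<times> int \<times> 'c) \<times> int \<times> 'c \<times> int"
    assume "x \<in> ({l \<in> carrier L. \<eta> l = \<one>\<^bsub>R\<^esub>} \<times> {0} \<times> carrier R) \<times> {0} \<times> carrier R2"
    then obtain l r s where x_eq: "x = ((l, 0, r), 0, s)" and
      m: "l \<in> carrier L" "\<eta> l = \<one>\<^bsub>R\<^esub>" "r \<in> carrier R" "s \<in> carrier R2" by auto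
    have p0: "0 \<in> {0..<int p}" using p_pos by auto
    have "x \<otimes>\<^bsub>E\<^esub> y = y \<otimes>\<^bsub>E\<^esub> x" if y: "y \<in> carrier E" for y
    proof -
      obtain l' a' r' b' s' where y_eq: "y = ((l', a', r'), b', s')" and
        m': "l' \<in> carrier L" "a' \<in> {0..<int p}" "r' \<in> carrier R" "b' \<in> {0..<int p}" "s' \<in> carrier R2"
        using E_cases[OF y] .
      show ?thesis
        unfolding x_eq y_eq commute_iff[OF m(1) p0 m(3) p0 m(4) m']
        using kernel_central'[OF m(1,2) m'(1)] m(2) by simp
    qed
    moreover have "x \<in> carrier E" unfolding carrier_E x_eq using m p0 by (auto simp: carrier_Zmod)
    ultimately show "x \<in> center E" unfolding center_def centralizer_def by auto
  qed
qed

lemma center_E_iff: "x \<in> carrier E \<Longrightarrow> x \<in> center E \<longleftrightarrow> \<theta> x = \<one>\<^bsub>R2 \<times>\<times> Zmod p\<^esub>"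
  unfolding center_E carrier_E by (auto simp: carrier_Zmod)

lemma card_center_E:
  "card (center E) = card {l \<in> carrier L. \<eta> l = \<one>\<^bsub>R\<^esub>} * card (carrier R) * card (carrier R) * p"
  unfolding center_E by (simp add: card_cartesian_product carrier_Zmod)

section \<open>Centralizers of elements with a nonzero twisting coordinate\<close>

definition M0 where "M0 = (carrier L \<times> {0::int} \<times> carrier R) \<times> {0::int} \<times> carrier R2"

lemma coordinate_homs: "(fst \<circ> snd \<circ> fst) \<in> hom E (Zmod p)" "(fst \<circ> snd) \<in> hom E (Zmod p)"
  unfolding E_def by (auto simp: hom_def)

text \<open>Take for \<open>\<chi>\<close> a twisting coordinate in which \<open>u\<close> is
  nonzero. If \<open>w\<close> commutes with \<open>u\<close> and vanishes there, the determinant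
  condition kills its other twisting coordinate, and a power of \<open>\<eta> l'\<close> with
  exponent prime to \<open>p\<close> is trivial; so \<open>w\<close> is central. This one statement
  yields both \<open>outside_Int\<close> and \<open>outside_card\<close>.\<close>

lemma separating_coordinate:
  assumes u: "u \<in> carrier E" "u \<notin> M0"
  shows "\<exists>\<chi> \<in> hom E (Zmod p). (\<forall>w \<in> centralizer E {u}. \<chi> w = 0 \<longrightarrow> w \<in> center E) \<and> (\<forall>w \<in> M0. \<chi> w = 0)"
proof -
  obtain l a r b s where u_eq: "u = ((l, a, r), b, s)" and
    m: "l \<in> carrier L" "a \<in> {0..<int p}" "r \<in> carrier R" "b \<in> {0..<int p}" "s \<in> carrier R2"
    using E_cases[OF u(1)] .
  \<comment> \<open>Z/p has no zero divisors, stated for integer representatives.\<close>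
  have no_zero_div: "x = 0" if "0 < c" "c < int p" "int p dvd x * c" "x \<in> {0..<int p}" for c x
  proof -
    have "\<not> int p dvd c" by (rule zdvd_not_zless[OF that(1,2)])
    then have "int p dvd x" using prime that(3) by (simp add: prime_dvd_mult_iff)
    then show "x = 0" using zdvd_not_zless[of x "int p"] that(4) by (cases "x = 0") auto
  qed
  show ?thesis
  proof (cases "a = 0")
    case False
    have "w \<in> center E" if w: "w \<in> centralizer E {u}" and w0: "(fst \<circ> snd \<circ> fst) w = 0" for w
    proof -
      have "w \<in> carrier E" using w unfolding centralizer_def by auto
      then obtain l' a' r' b' s' where w_eq': "w = ((l', a', r'), b', s')" and
        m': "l' \<in> carrier L" "a' \<in> {0..<int p}" "r' \<in> carrier R" "b' \<in> {0..<int p}" "s' \<in> carrier R2"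
        by (rule E_cases)
      have zero: "a' = 0" using w0 unfolding w_eq' by simp
      note w_eq = w_eq'[unfolded zero] and m' = m'[unfolded zero]
      have "u \<otimes>\<^bsub>E\<^esub> w = w \<otimes>\<^bsub>E\<^esub> u" using w unfolding centralizer_def by auto
      then have c: "\<eta> l [^]\<^bsub>R\<^esub> (0::int) = \<eta> l' [^]\<^bsub>R\<^esub> a" "(b' * a) mod int p = (b * 0) mod int p"
        unfolding u_eq w_eq commute_iff[OF m m'] by auto
      have "int p dvd b' * a" unfolding dvd_eq_mod_eq_0 c(2) by simp
      then have "b' = 0" using no_zero_div[of a b'] m(2) False m'(4) by simp
      moreover have "\<eta> l' = \<one>\<^bsub>R\<^esub>"
        using R.int_pow_eq_one_prime_exponent[OF exponent prime, of "\<eta> l'" a] c(1) m(2) False m'(1) by simp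
      ultimately show ?thesis unfolding center_E w_eq using m' by simp
    qed
    then show ?thesis using coordinate_homs(1) by (intro bexI[of _ "fst \<circ> snd \<circ> fst"]) (auto simp: M0_def)
  next
    case True
    then have b: "0 < b" "b < int p" using u(2) m unfolding M0_def u_eq by auto
    have "w \<in> center E" if w: "w \<in> centralizer E {u}" and w0: "(fst \<circ> snd) w = 0" for w
    proof -
      have "w \<in> carrier E" using w unfolding centralizer_def by auto
      then obtain l' a' r' b' s' where w_eq': "w = ((l', a', r'), b', s')" and
        m': "l' \<in> carrier L" "a' \<in> {0..<int p}" "r' \<in> carrier R" "b' \<in> {0..<int p}" "s' \<in> carrier R2"
        by (rule E_cases)
      have zero: "b' = 0" using w0 unfolding w_eq' by simp
      note w_eq = w_eq'[unfolded zero] and m' = m'[unfolded zero]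
      have "u \<otimes>\<^bsub>E\<^esub> w = w \<otimes>\<^bsub>E\<^esub> u" using w unfolding centralizer_def by auto
      then have c: "\<eta> l [^]\<^bsub>R\<^esub> (0::int) = \<eta> l' [^]\<^bsub>R\<^esub> b" "(0 * a) mod int p = (b * a') mod int p"
        unfolding u_eq w_eq commute_iff[OF m m'] by auto
      have "int p dvd a' * b" unfolding dvd_eq_mod_eq_0 mult.commute[of a'] c(2)[symmetric] by simp
      then have "a' = 0" using no_zero_div[OF b] m'(2) by simp
      moreover have "\<eta> l' = \<one>\<^bsub>R\<^esub>"
        using R.int_pow_eq_one_prime_exponent[OF exponent prime, of "\<eta> l'" b] c(1) b m'(1) by simp
      ultimately show ?thesis unfolding center_E w_eq using m' by simp
    qed
    then show ?thesis using coordinate_homs(2) by (intro bexI[of _ "fst \<circ> snd"]) (auto simp: M0_def)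
  qed
qed

lemma E_nat_pow:
  assumes "l \<in> carrier L" "r \<in> carrier R" "s \<in> carrier R2"
  shows "((l, 0, r), 0, s) [^]\<^bsub>E\<^esub> (n::nat) = ((l [^]\<^bsub>L\<^esub> n, 0, r [^]\<^bsub>R\<^esub> n), 0, s [^]\<^bsub>R2\<^esub> n)"
  unfolding E_def using assms
  by (subst twisting.twist_nat_pow[OF twisting_twist]) (auto simp: twist_nat_pow p_pos carrier_Zmod)

text \<open>When both twisting coordinates are zero, all cocycle values are trivial.\<close>

lemma M0_mult:
  assumes "l \<in> carrier L" "l' \<in> carrier L" "r \<in> carrier R" "r' \<in> carrier R" "s \<in> carrier R2" "s' \<in> carrier R2"
  shows "((l, 0, r), 0, s) \<otimes>\<^bsub>E\<^esub> ((l', 0, r'), 0, s') = ((l \<otimes>\<^bsub>L\<^esub> l', 0, r \<otimes>\<^bsub>R\<^esub> r'), 0, s \<otimes>\<^bsub>R2\<^esub> s')"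
proof -
  obtain s1 s2 where s: "s = (s1, s2)" "s1 \<in> carrier R" "s2 \<in> carrier (Zmod p)" using assms(5) by auto
  obtain t1 t2 where t: "s' = (t1, t2)" "t1 \<in> carrier R" "t2 \<in> carrier (Zmod p)" using assms(6) by auto
  show ?thesis
    unfolding E_def using assms(1-4) s t by (simp add: mod_simps)
qed

end

section \<open>Isomorphic copies on the natural numbers\<close>

lemma (in group) center_normal: "center G \<lhd> G"
proof (rule normal_invI[OF subgroup_center])
  fix x h assume "x \<in> carrier G" "h \<in> center G"
  moreover from this have "x \<otimes> h = h \<otimes> x" "h \<in> carrier G" unfolding center_def centralizer_def by auto
  ultimately show "x \<otimes> h \<otimes> inv x \<in> center G" by (simp add: m_assoc)
qed

lemma iso_image_centralizer:
  assumes f: "f \<in> iso G G'" and U: "U \<subseteq> carrier G"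
    and closed: "\<And>x y. \<lbrakk>x \<in> carrier G; y \<in> carrier G\<rbrakk> \<Longrightarrow> x \<otimes>\<^bsub>G\<^esub> y \<in> carrier G"
  shows "f ` centralizer G U = centralizer G' (f ` U)"
proof -
  have f': "f \<in> hom G G'" "inj_on f (carrier G)" "carrier G' = f ` carrier G"
    using f unfolding iso_def bij_betw_def by auto
  have "f x \<otimes>\<^bsub>G'\<^esub> f u = f u \<otimes>\<^bsub>G'\<^esub> f x \<longleftrightarrow> x \<otimes>\<^bsub>G\<^esub> u = u \<otimes>\<^bsub>G\<^esub> x"
    if "x \<in> carrier G" "u \<in> carrier G" for x u
    using that f' closed by (metis hom_mult inj_on_contraD)
  then show ?thesis
    unfolding centralizer_def f'(3) using U by (auto simp: subset_iff)
qed

text \<open>The theorem asks for a group on \<open>nat\<close>, whereas \<open>E\<close> consists of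
  nested tuples over the type of \<open>H\<close>.\<close>

lemma (in group) nat_isomorphic_copy:
  assumes "finite (carrier G)"
  obtains G' :: "nat monoid" and f where "group G'" "f \<in> iso G G'"
proof -
  obtain f :: "'a \<Rightarrow> nat" where f: "inj_on f (carrier G)"
    using finite_imp_inj_to_nat_seg[OF assms] by blast
  let ?G' = "image_group f G"
  have hom: "f \<in> hom G ?G'"
    using f by (auto simp: hom_def image_group_def)
  then have iso: "f \<in> iso G ?G'"
    using f unfolding iso_def bij_betw_def by (simp add: image_group_carrier)
  \<comment> \<open>The rule resets the unit to \<open>f \<one>\<close>, which already is the unit
    of \<open>image_group\<close>.\<close>
  have "group (?G'\<lparr>one := f \<one>\<rparr>)" by (rule iso_imp_img_group[OF iso])
  then have "group ?G'" by (simp add: image_group_def)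
  then show thesis using iso that by blast
qed

text \<open>Moving the hypotheses of the criterion, instead of its conclusion, lets the lattice be
  computed directly in the copy.\<close>

lemma (in cd_extension) iso_cd_extension:
  assumes f: "f \<in> iso G G'" and G': "group G'"
  shows "cd_extension G' H (f \<circ> \<phi>) (f ` N) p"
proof -
  interpret f: group_hom G G' f
    using f G' unfolding iso_def group_hom_def group_hom_axioms_def by auto
  have inj: "inj_on f (carrier G)" and surj: "f ` carrier G = carrier G'"
    using f unfolding iso_def bij_betw_def by auto
  have NG: "N \<subseteq> carrier G" by auto
  have card_image_f: "card (f ` U) = card U" if "U \<subseteq> carrier G" for U
    using inj_on_subset[OF inj that] by (rule card_image)
  have cent: "centralizer G' (f ` U) = f ` centralizer G U" if "U \<subseteq> carrier G" for U
    using iso_image_centralizer[OF f that] by simp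
  have center: "center G' = f ` center G"
    unfolding center_def surj[symmetric] by (simp add: cent)
  have M': "f ` N <#>\<^bsub>G'\<^esub> (f \<circ> \<phi>) ` carrier H = f ` M"
    using set_mult_hom[OF f.homh NG, of "\<phi> ` carrier H"] by (auto simp: image_comp)
  have zG: "center G \<subseteq> carrier G" by (rule subgroup.subset[OF G.subgroup_center])
  show ?thesis
  proof (intro cd_extension.intro cd_extension_axioms.intro)
    show "group G'" "group H" by (fact G', rule H.group_axioms)
    show "finite (carrier G')" using finite_G surj by (metis finite_imageI)
    show "carrier H \<in> CD_lattice H" by (rule H_in_CD)
    have "\<phi> \<in> hom H G" "inj_on \<phi> (carrier H)" using mon unfolding mon_def by auto
    then show "f \<circ> \<phi> \<in> mon H G'"
      unfolding mon_def using hom_compose[of \<phi> H G f G'] f.homh inj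
      by (auto intro!: comp_inj_on intro: inj_on_subset)
    show "f ` N \<lhd> G'"
    proof (rule f.H.normal_invI)
      show "subgroup (f ` N) G'" by (rule f.subgroup_img_is_subgroup[OF subgroup_N])
      fix x h assume "x \<in> carrier G'" "h \<in> f ` N"
      then obtain y n where yn: "y \<in> carrier G" "x = f y" "n \<in> N" "h = f n"
        unfolding surj[symmetric] by (elim imageE)
      then have "x \<otimes>\<^bsub>G'\<^esub> h \<otimes>\<^bsub>G'\<^esub> inv\<^bsub>G'\<^esub> x = f (y \<otimes>\<^bsub>G\<^esub> n \<otimes>\<^bsub>G\<^esub> inv\<^bsub>G\<^esub> y)" by simp
      then show "x \<otimes>\<^bsub>G'\<^esub> h \<otimes>\<^bsub>G'\<^esub> inv\<^bsub>G'\<^esub> x \<in> f ` N"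
        using G.normal_invE(2)[OF normal_N yn(1,3)] by simp
    qed
    have "f ` N \<inter> (f \<circ> \<phi>) ` carrier H = f ` (N \<inter> \<phi> ` carrier H)"
      unfolding image_comp[symmetric] by (rule inj_on_image_Int[OF inj NG, symmetric]) auto
    then show "f ` N \<inter> (f \<circ> \<phi>) ` carrier H = {\<one>\<^bsub>G'\<^esub>}" using N_Int by simp
    show "n \<otimes>\<^bsub>G'\<^esub> (f \<circ> \<phi>) h = (f \<circ> \<phi>) h \<otimes>\<^bsub>G'\<^esub> n" if n: "n \<in> f ` N" and h: "h \<in> carrier H" for n h
    proof -
      obtain m where m: "m \<in> N" "n = f m" using n by auto
      then have "f (m \<otimes>\<^bsub>G\<^esub> \<phi> h) = f (\<phi> h \<otimes>\<^bsub>G\<^esub> m)" using N_commute h by simp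
      then show ?thesis using m h by simp
    qed
    show "centralizer G' (f ` N) = f ` N <#>\<^bsub>G'\<^esub> (f \<circ> \<phi>) ` carrier H"
      unfolding M' cent[OF NG] centralizer_N ..
    show "\<not> f ` N \<subseteq> center G'"
    proof
      assume "f ` N \<subseteq> center G'"
      then have "n \<in> center G" if "n \<in> N" for n
        unfolding center using that zG by (meson N_closed image_subset_iff inj inj_on_image_mem_iff)
      then show False using N_not_central by blast
    qed
    show "centralizer G' {u} \<inter> (f ` N <#>\<^bsub>G'\<^esub> (f \<circ> \<phi>) ` carrier H) \<subseteq> center G'"
      and "card (centralizer G' {u}) \<le> p * card (center G')"
      if u: "u \<in> carrier G'" "u \<notin> f ` N <#>\<^bsub>G'\<^esub> (f \<circ> \<phi>) ` carrier H" for u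
    proof -
      obtain v where v0: "v \<in> carrier G" "u = f v"
        using u(1) unfolding surj[symmetric] by (elim imageE)
      then have v: "v \<in> carrier G" "v \<notin> M" "u = f v" using u(2) unfolding M' by auto
      have c: "centralizer G' {u} = f ` centralizer G {v}" using cent[of "{v}"] v by simp
      show "centralizer G' {u} \<inter> (f ` N <#>\<^bsub>G'\<^esub> (f \<circ> \<phi>) ` carrier H) \<subseteq> center G'"
        unfolding M' c center inj_on_image_Int[OF inj centralizer_subset M_subset, symmetric]
        using outside_Int[OF v(1,2)] by (rule image_mono)
      show "card (centralizer G' {u}) \<le> p * card (center G')"
        unfolding c center card_image_f[OF zG] card_image_f[OF centralizer_subset]
        by (rule outside_card[OF v(1,2)])
    qed
    show "p * p * card (center G') < card (carrier G')"
      unfolding center card_image_f[OF zG] surj[symmetric] using center_small card_image_f by simp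
    show "card (carrier G') * card (center G') = card (f ` N) * card (f ` N) * (card (carrier H) * card (center H))"
      unfolding center card_image_f[OF zG] card_image_f[OF NG] surj[symmetric]
      using card_eq card_image_f by simp
  qed
qed

section \<open>Groups of class two\<close>

text \<open>Commutators die in the abelian group \<open>A\<close>, hence are central; this is the
  source of class two.\<close>

locale central_kernel = G: group G + A: comm_group A
  for G (structure) and A (structure) +
  fixes \<theta>
  assumes hom: "\<theta> \<in> hom G A"
    and kernel_iff: "x \<in> carrier G \<Longrightarrow> x \<in> center G \<longleftrightarrow> \<theta> x = \<one>\<^bsub>A\<^esub>"
begin

sublocale theta: group_hom G A \<theta>
  by unfold_locales (rule hom)

lemma commutator_central:
  assumes "x \<in> carrier G" "y \<in> carrier G"
  shows "x \<otimes>\<^bsub>G\<^esub> y \<otimes>\<^bsub>G\<^esub> inv\<^bsub>G\<^esub> x \<otimes>\<^bsub>G\<^esub> inv\<^bsub>G\<^esub> y \<in> center G"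
proof -
  have "\<theta> (x \<otimes>\<^bsub>G\<^esub> y \<otimes>\<^bsub>G\<^esub> inv\<^bsub>G\<^esub> x \<otimes>\<^bsub>G\<^esub> inv\<^bsub>G\<^esub> y)
      = \<theta> y \<otimes>\<^bsub>A\<^esub> \<theta> x \<otimes>\<^bsub>A\<^esub> inv\<^bsub>A\<^esub> \<theta> x \<otimes>\<^bsub>A\<^esub> inv\<^bsub>A\<^esub> \<theta> y"
    using assms by (simp add: A.m_comm)
  also have "\<dots> = \<one>\<^bsub>A\<^esub>" using assms by (simp add: A.m_assoc)
  finally show ?thesis using assms by (simp add: kernel_iff)
qed

lemma elementary_abelian_Mod_center:
  assumes "has_exponent A p"
  shows "elementary_abelian p (G Mod center G)"
proof -
  interpret Z: normal "center G" G by (rule G.center_normal)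
  interpret Q: group "G Mod center G" by (rule Z.factorgroup_is_group)
  \<comment> \<open>Elements with equal image differ by a kernel element, so identities of G/Z(G)
    may be checked in \<open>A\<close>.\<close>
  have coset: "center G #>\<^bsub>G\<^esub> x = center G #>\<^bsub>G\<^esub> y"
    if "x \<in> carrier G" "y \<in> carrier G" "\<theta> x = \<theta> y" for x y
  proof -
    have "x \<otimes>\<^bsub>G\<^esub> inv\<^bsub>G\<^esub> y \<in> center G" using that by (simp add: kernel_iff)
    then have "x \<in> center G #>\<^bsub>G\<^esub> y" using that by (simp add: Z.rcos_module)
    then show ?thesis using G.repr_independence[OF _ that(2) Z.subgroup_axioms] by simp
  qed
  have "comm_group (G Mod center G)"
  proof (rule Q.group_comm_groupI)
    fix U V assume "U \<in> carrier (G Mod center G)" "V \<in> carrier (G Mod center G)"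
    then obtain x y where xy: "x \<in> carrier G" "U = center G #>\<^bsub>G\<^esub> x" "y \<in> carrier G" "V = center G #>\<^bsub>G\<^esub> y"
      unfolding carrier_FactGroup by auto
    have "center G #>\<^bsub>G\<^esub> (x \<otimes>\<^bsub>G\<^esub> y) = center G #>\<^bsub>G\<^esub> (y \<otimes>\<^bsub>G\<^esub> x)"
      using xy by (intro coset) (auto simp: A.m_comm)
    then show "U \<otimes>\<^bsub>G Mod center G\<^esub> V = V \<otimes>\<^bsub>G Mod center G\<^esub> U"
      using xy by (simp add: Z.rcos_sum)
  qed
  moreover have "U [^]\<^bsub>G Mod center G\<^esub> p = \<one>\<^bsub>G Mod center G\<^esub>"
    if U: "U \<in> carrier (G Mod center G)" for U
  proof -
    obtain x where x: "x \<in> carrier G" "U = center G #>\<^bsub>G\<^esub> x"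
      using U unfolding carrier_FactGroup by auto
    have "x [^]\<^bsub>G\<^esub> p \<in> center G"
      using assms x unfolding has_exponent_def by (simp add: kernel_iff theta.hom_nat_pow)
    then show ?thesis
      using x G.coset_join2[OF _ Z.subgroup_axioms] by (simp add: Z.FactGroup_pow)
  qed
  ultimately show ?thesis unfolding elementary_abelian_def by blast
qed

text \<open>\<open>lower_central\<close> is indexed from 0, so term 1 is the commutator subgroup. It
  is central, which makes term 2 trivial; a noncommuting pair keeps terms 0 and 1
  nontrivial.\<close>

lemma class_two:
  assumes "center G \<noteq> carrier G"
  shows "nilpotent G" "nilpotency_class G = 2"
proof -
  let ?C = "\<Union>x \<in> carrier G. \<Union>y \<in> carrier G. {x \<otimes>\<^bsub>G\<^esub> y \<otimes>\<^bsub>G\<^esub> inv\<^bsub>G\<^esub> x \<otimes>\<^bsub>G\<^esub> inv\<^bsub>G\<^esub> y}"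
  have l1: "lower_central G 1 = generate G ?C" by simp
  have sub: "lower_central G 1 \<subseteq> center G"
    unfolding l1 using commutator_central by (intro G.generate_subgroup_incl G.subgroup_center) auto
  have "x \<otimes>\<^bsub>G\<^esub> y \<otimes>\<^bsub>G\<^esub> inv\<^bsub>G\<^esub> x \<otimes>\<^bsub>G\<^esub> inv\<^bsub>G\<^esub> y = \<one>\<^bsub>G\<^esub>" if "x \<in> lower_central G 1" "y \<in> carrier G" for x y
  proof -
    have "x \<in> center G" using that sub by auto
    then have "x \<in> carrier G" "x \<otimes>\<^bsub>G\<^esub> y = y \<otimes>\<^bsub>G\<^esub> x"
      using that unfolding center_def centralizer_def by auto
    then show ?thesis using that by (simp add: G.m_assoc)
  qed
  moreover have "\<one>\<^bsub>G\<^esub> \<in> lower_central G 1" unfolding l1 by (rule generate.one)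
  ultimately have "(\<Union>x \<in> lower_central G 1. \<Union>y \<in> carrier G.
      {x \<otimes>\<^bsub>G\<^esub> y \<otimes>\<^bsub>G\<^esub> inv\<^bsub>G\<^esub> x \<otimes>\<^bsub>G\<^esub> inv\<^bsub>G\<^esub> y}) \<subseteq> {\<one>\<^bsub>G\<^esub>}" by auto
  then have "lower_central G (Suc 1) \<subseteq> {\<one>\<^bsub>G\<^esub>}"
    unfolding lower_central.simps(2)[of G 1] by (rule G.generate_subgroup_incl[OF _ G.triv_subgroup])
  moreover have "\<one>\<^bsub>G\<^esub> \<in> lower_central G (Suc 1)"
    unfolding lower_central.simps(2)[of G 1] by (rule generate.one)
  ultimately have l2: "lower_central G 2 = {\<one>\<^bsub>G\<^esub>}" unfolding numeral_2_eq_2 by auto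
  then show "nilpotent G" unfolding nilpotent_def by blast
  obtain x where "x \<in> carrier G" "x \<notin> center G"
    using assms subgroup.subset[OF G.subgroup_center] by auto
  then obtain y where xy: "x \<in> carrier G" "y \<in> carrier G" "x \<otimes>\<^bsub>G\<^esub> y \<noteq> y \<otimes>\<^bsub>G\<^esub> x"
    unfolding center_def centralizer_def by auto
  have ne1: "lower_central G 1 \<noteq> {\<one>\<^bsub>G\<^esub>}"
  proof
    assume "lower_central G 1 = {\<one>\<^bsub>G\<^esub>}"
    then have "x \<otimes>\<^bsub>G\<^esub> y \<otimes>\<^bsub>G\<^esub> inv\<^bsub>G\<^esub> x \<otimes>\<^bsub>G\<^esub> inv\<^bsub>G\<^esub> y = \<one>\<^bsub>G\<^esub>"
      unfolding l1 using xy generate.incl[of _ ?C G] by blast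
    then have "x \<otimes>\<^bsub>G\<^esub> y \<otimes>\<^bsub>G\<^esub> inv\<^bsub>G\<^esub> x = y"
      using xy G.inv_solve_right'[of "\<one>\<^bsub>G\<^esub>" "x \<otimes>\<^bsub>G\<^esub> y \<otimes>\<^bsub>G\<^esub> inv\<^bsub>G\<^esub> x" y] by simp
    then show False
      using xy G.inv_solve_right'[of y "x \<otimes>\<^bsub>G\<^esub> y" x] by simp
  qed
  have ne0: "lower_central G 0 \<noteq> {\<one>\<^bsub>G\<^esub>}" using xy by auto
  show "nilpotency_class G = 2"
    unfolding nilpotency_class_def
  proof (rule Least_equality[of "\<lambda>c. lower_central G c = {\<one>\<^bsub>G\<^esub>}", OF l2])
    fix c assume c: "lower_central G c = {\<one>\<^bsub>G\<^esub>}"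
    have "c \<noteq> 0" "c \<noteq> 1" using c ne0 ne1 by metis+
    then show "2 \<le> c" by simp
  qed
qed

end

text \<open>The center is abelian in any case, so only the condition on powers remains.\<close>

lemma (in group) elementary_abelian_center_iff:
  "elementary_abelian p (G\<lparr>carrier := center G\<rparr>) \<longleftrightarrow> (\<forall>z \<in> center G. z [^] p = \<one>)"
proof -
  have "group (G\<lparr>carrier := center G\<rparr>)"
    using subgroup.subgroup_is_group[OF subgroup_center group_axioms] .
  moreover have "x \<otimes> y = y \<otimes> x" if "x \<in> center G" "y \<in> center G" for x y
    using that unfolding center_def centralizer_def by blast
  ultimately have "comm_group (G\<lparr>carrier := center G\<rparr>)"
    by (intro group.group_comm_groupI) simp_all
  then show ?thesis
    unfolding elementary_abelian_def by (simp add: nat_pow_consistent[symmetric])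
qed

section \<open>The extension attached to a group\<close>

abbreviation plane where "plane p \<equiv> Zmod p \<times>\<times> Zmod p"

text \<open>Serves as \<open>\<eta>\<close>. The second component is kept intact so that the
  commutators detect the plane inside \<open>N\<close>.\<close>

definition quot_hom :: "('a, 'b) monoid_scheme \<Rightarrow> 'a \<times> 'c \<Rightarrow> 'a set \<times> 'c" where
  "quot_hom H = (\<lambda>(h, x). (center H #>\<^bsub>H\<^esub> h, x))"

lemma quot_hom_simp [simp]: "quot_hom H (h, x) = (center H #>\<^bsub>H\<^esub> h, x)"
  by (simp add: quot_hom_def)

locale cd_construction = H: group H for H (structure) +
  fixes p :: nat
  assumes prime_p: "Factorial_Ring.prime p"
    and finite_H: "finite (carrier H)"
    and H_in_CD: "carrier H \<in> CD_lattice H"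
    and elementary: "elementary_abelian p (H Mod center H)"
begin

lemma coset_center_iff: "h \<in> carrier H \<Longrightarrow> center H #>\<^bsub>H\<^esub> h = center H \<longleftrightarrow> h \<in> center H"
  using H.coset_join1[OF _ _ H.subgroup_center] H.coset_join2[OF _ H.subgroup_center] by blast

lemma kernel_quot_hom:
  "{l \<in> carrier (H \<times>\<times> plane p). quot_hom H l = \<one>\<^bsub>(H Mod center H) \<times>\<times> plane p\<^esub>} = center H \<times> {(0, 0)}"
  using prime_gt_0_nat[OF prime_p] subgroup.subset[OF H.subgroup_center]
  by (auto simp: coset_center_iff)

text \<open>That H/Z(H) is elementary abelian makes \<open>R\<close> abelian of exponent dividing
  \<open>p\<close>, so powers by residues mod \<open>p\<close> make sense. The kernel of
  \<open>quot_hom\<close> is Z(H) x 1, which is central in \<open>L\<close>.\<close>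

sublocale double_twisting "H \<times>\<times> plane p" "(H Mod center H) \<times>\<times> plane p" "quot_hom H" p
proof (intro double_twisting.intro double_twisting_axioms.intro twisting.intro twisting_axioms.intro)
  interpret Z: normal "center H" H by (rule H.center_normal)
  show "group (H \<times>\<times> plane p)"
    by (intro DirProd_group H.group_axioms group_integer_mod_group)
  show "comm_group ((H Mod center H) \<times>\<times> plane p)"
    using elementary unfolding elementary_abelian_def
    by (intro DirProd_comm_group abelian_integer_mod_group) blast
  show "quot_hom H \<in> hom (H \<times>\<times> plane p) ((H Mod center H) \<times>\<times> plane p)"
    by (rule homI) (auto simp: carrier_FactGroup Z.rcos_sum)
  show "Factorial_Ring.prime p" by (rule prime_p)
  show "has_exponent ((H Mod center H) \<times>\<times> plane p) p"
    using elementary unfolding elementary_abelian_def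
    by (intro DirProd_has_exponent Zmod_has_exponent) (simp add: has_exponent_def)
  show "finite (carrier (H \<times>\<times> plane p))" "finite (carrier ((H Mod center H) \<times>\<times> plane p))"
    using finite_H prime_gt_0_nat[OF prime_p] by (auto simp: carrier_integer_mod_group carrier_FactGroup)
  fix l assume "l \<in> carrier (H \<times>\<times> plane p)" "quot_hom H l = \<one>\<^bsub>(H Mod center H) \<times>\<times> plane p\<^esub>"
  then have "l \<in> center H \<times> {(0, 0)}" unfolding kernel_quot_hom[symmetric] by simp
  then obtain h where h: "h \<in> center H" "l = (h, 0, 0)" by auto
  have "h \<otimes>\<^bsub>H\<^esub> k = k \<otimes>\<^bsub>H\<^esub> h" if "k \<in> carrier H" for k
    using h(1) that unfolding center_def centralizer_def by blast
  moreover have "h \<in> carrier H" using h(1) subgroup.subset[OF H.subgroup_center] by blast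
  ultimately show "l \<in> center (H \<times>\<times> plane p)"
    unfolding center_def centralizer_def h(2)
    using prime_gt_0_nat[OF prime_p] by (auto simp: carrier_integer_mod_group)
qed

abbreviation L where "L \<equiv> H \<times>\<times> plane p"
abbreviation R where "R \<equiv> (H Mod center H) \<times>\<times> plane p"

section \<open>The copy of H and the normal subgroup N\<close>

definition emb where "emb h = (((h, (0::int, 0::int)), 0::int, \<one>\<^bsub>R\<^esub>), 0::int, \<one>\<^bsub>R2\<^esub>)"

text \<open>All central coordinates are included along with the plane, so that N Z(H) contains
  Z(E).\<close>

definition N where "N = (({\<one>\<^bsub>H\<^esub>} \<times> carrier (plane p)) \<times> {0::int} \<times> carrier R) \<times> {0::int} \<times> carrier R2"

lemma comm_group_R2: "comm_group R2"
  by (intro DirProd_comm_group[OF R.comm_group_axioms abelian_integer_mod_group])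

lemma center_in_Mod [simp]: "center H \<in> carrier (H Mod center H)"
  using R.one_closed by simp

lemma one_E: "\<one>\<^bsub>E\<^esub> = (((\<one>\<^bsub>H\<^esub>, (0, 0)), 0, \<one>\<^bsub>R\<^esub>), 0, \<one>\<^bsub>R2\<^esub>)"
  by (simp add: E_def)

lemma zero_in: "0 \<in> {0..<int p}" "(0, 0) \<in> carrier (plane p)"
  using p_pos by auto

lemma emb_hom: "emb \<in> hom H E"
proof (rule homI)
  show "emb h \<in> carrier E" if "h \<in> carrier H" for h
    using that p_pos unfolding emb_def E_def carrier_twist carrier_Zmod by (simp add: carrier_Zmod)
  show "emb (h \<otimes>\<^bsub>H\<^esub> k) = emb h \<otimes>\<^bsub>E\<^esub> emb k" if "h \<in> carrier H" "k \<in> carrier H" for h k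
  proof -
    interpret R2: comm_group R2 by (rule comm_group_R2)
    have "(h, (0, 0)) \<otimes>\<^bsub>L\<^esub> (k, (0, 0)) = (h \<otimes>\<^bsub>H\<^esub> k, (0, 0))" by simp
    moreover have "(h, (0, 0)) \<in> carrier L" "(k, (0, 0)) \<in> carrier L"
      using that zero_in by simp_all
    ultimately show ?thesis
      unfolding emb_def
      using M0_mult R.r_one[OF R.one_closed] R2.r_one[OF R2.one_closed] R.one_closed R2.one_closed
      by metis
  qed
qed

lemma emb_mon: "emb \<in> mon H E"
  unfolding mon_def using emb_hom by (auto simp: inj_on_def emb_def)

lemma N_normal: "N \<lhd> E"
proof -
  \<comment> \<open>\<open>N\<close> is the kernel of the map keeping the \<open>H\<close>
    coordinate and both twisting coordinates.\<close>
  let ?\<psi> = "\<lambda>(((h, x), a, r), b, s). (h, a, b)"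
  have "group_hom E (H \<times>\<times> plane p) ?\<psi>"
    unfolding group_hom_def group_hom_axioms_def
    using group_E L.group_axioms by (auto simp: E_def hom_def)
  moreover have "kernel E (H \<times>\<times> plane p) ?\<psi> = N"
    using p_pos unfolding N_def E_def kernel_def carrier_twist carrier_Zmod by auto
  ultimately show ?thesis using group_hom.normal_kernel by metis
qed

lemma N_Int: "N \<inter> emb ` carrier H = {\<one>\<^bsub>E\<^esub>}"
proof -
  have "\<one>\<^bsub>E\<^esub> = emb \<one>\<^bsub>H\<^esub>"
    by (simp add: one_E emb_def)
  moreover have "emb \<one>\<^bsub>H\<^esub> \<in> N"
    using zero_in L.one_closed R.one_closed unfolding emb_def N_def by (auto simp: carrier_Zmod)
  ultimately show ?thesis by (auto simp: N_def emb_def)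
qed

lemma set_mult_N: "N <#>\<^bsub>E\<^esub> emb ` carrier H = M0"
proof
  have eq: "(((\<one>\<^bsub>H\<^esub>, x), 0, r), 0, s) \<otimes>\<^bsub>E\<^esub> emb h = (((h, x), 0, r), 0, s)"
    if "x \<in> carrier (plane p)" "r \<in> carrier R" "s \<in> carrier R2" "h \<in> carrier H" for x r s h
  proof -
    have "(\<one>\<^bsub>H\<^esub>, x) \<otimes>\<^bsub>L\<^esub> (h, (0, 0)) = (h, x)"
      using that(1,4) by (auto simp: carrier_Zmod)
    moreover have "s \<otimes>\<^bsub>R2\<^esub> \<one>\<^bsub>R2\<^esub> = s"
      using that(3) comm_group_R2 by (meson comm_group_def comm_monoid_def monoid.r_one)
    moreover have "(\<one>\<^bsub>H\<^esub>, x) \<in> carrier L" "(h, (0, 0)) \<in> carrier L" "\<one>\<^bsub>R2\<^esub> \<in> carrier R2"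
      using that zero_in by simp_all
    ultimately show ?thesis
      unfolding emb_def using M0_mult R.r_one[OF that(2)] R.one_closed that(2,3) by metis
  qed
  show "N <#>\<^bsub>E\<^esub> emb ` carrier H \<subseteq> M0"
  proof
    fix y assume "y \<in> N <#>\<^bsub>E\<^esub> emb ` carrier H"
    then obtain x r s h where "x \<in> carrier (plane p)" "r \<in> carrier R" "s \<in> carrier R2" "h \<in> carrier H"
      "y = (((\<one>\<^bsub>H\<^esub>, x), 0, r), 0, s) \<otimes>\<^bsub>E\<^esub> emb h"
      unfolding set_mult_def N_def by blast
    then show "y \<in> M0" using eq unfolding M0_def by auto
  qed
  show "M0 \<subseteq> N <#>\<^bsub>E\<^esub> emb ` carrier H"
  proof
    fix y assume "y \<in> M0"
    then obtain h x r s where y: "x \<in> carrier (plane p)" "r \<in> carrier R" "s \<in> carrier R2" "h \<in> carrier H"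
      "y = (((h, x), 0, r), 0, s)"
      unfolding M0_def carrier_DirProd[of H] by blast
    then have "(((\<one>\<^bsub>H\<^esub>, x), 0, r), 0, s) \<in> N" unfolding N_def by blast
    then show "y \<in> N <#>\<^bsub>E\<^esub> emb ` carrier H"
      unfolding y(5) eq[OF y(1-4), symmetric] set_mult_def using y(4) by blast
  qed
qed

text \<open>A witness in \<open>N\<close> with nontrivial \<open>\<eta>\<close> value: it shows that
  \<open>N\<close> is not central, and commuting with it alone forces both twisting coordinates to
  vanish.\<close>

definition n0 where "n0 = (((\<one>\<^bsub>H\<^esub>, (1::int, 0::int)), 0::int, \<one>\<^bsub>R\<^esub>), 0::int, \<one>\<^bsub>R2\<^esub>)"

lemma n0: "n0 \<in> N" "(\<one>\<^bsub>H\<^esub>, (1, 0)) \<in> carrier L" "quot_hom H (\<one>\<^bsub>H\<^esub>, (1, 0)) \<noteq> \<one>\<^bsub>R\<^esub>"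
proof -
  have one: "1 \<in> carrier (Zmod p)" using prime_gt_1_nat[OF prime] by auto
  show "n0 \<in> N" unfolding n0_def N_def using one by auto
  show "(\<one>\<^bsub>H\<^esub>, (1, 0)) \<in> carrier L" using one by auto
  show "quot_hom H (\<one>\<^bsub>H\<^esub>, (1, 0)) \<noteq> \<one>\<^bsub>R\<^esub>" by simp
qed

lemma N_not_central: "\<not> N \<subseteq> center E"
  using n0 unfolding center_E n0_def by blast

text \<open>The first inclusion tests against \<open>n0\<close> only. For the second, a = b = 0
  leaves just the condition that the \<open>L\<close> coordinates commute, and the plane is central
  in \<open>L\<close>.\<close>

lemma centralizer_N: "centralizer E N = M0"
proof
  show "centralizer E N \<subseteq> M0"
  proof
    fix w assume w: "w \<in> centralizer E N"
    then have "w \<in> carrier E" unfolding centralizer_def by blast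
    then obtain l a r b s where w_eq: "w = ((l, a, r), b, s)" and
      m: "l \<in> carrier L" "a \<in> {0..<int p}" "r \<in> carrier R" "b \<in> {0..<int p}" "s \<in> carrier R2"
      by (rule E_cases)
    have "w \<otimes>\<^bsub>E\<^esub> n0 = n0 \<otimes>\<^bsub>E\<^esub> w" using w n0(1) unfolding centralizer_def by blast
    moreover have "\<one>\<^bsub>R2\<^esub> \<in> carrier R2" by simp
    ultimately have c: "\<one>\<^bsub>R\<^esub> = quot_hom H (\<one>\<^bsub>H\<^esub>, (1, 0)) [^]\<^bsub>R\<^esub> a"
      "\<one>\<^bsub>R\<^esub> = quot_hom H (\<one>\<^bsub>H\<^esub>, (1, 0)) [^]\<^bsub>R\<^esub> b"
      unfolding w_eq n0_def
      using commute_iff[OF m n0(2) zero_in(1) R.one_closed zero_in(1)] by (metis int_pow_0)+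
    have "c = 0" if "quot_hom H (\<one>\<^bsub>H\<^esub>, (1, 0)) [^]\<^bsub>R\<^esub> c = \<one>\<^bsub>R\<^esub>" "c \<in> {0..<int p}" for c
      using R.int_pow_eq_one_prime_exponent[OF exponent prime eta_closed[OF n0(2)], of c] n0(3) that
      by fastforce
    then have "a = 0" "b = 0" using c m by simp_all
    then show "w \<in> M0" unfolding M0_def w_eq using m by blast
  qed
  show "M0 \<subseteq> centralizer E N"
  proof
    fix w assume "w \<in> M0"
    then obtain h x r s where w: "x \<in> carrier (plane p)" "r \<in> carrier R" "s \<in> carrier R2" "h \<in> carrier H"
      "w = (((h, x), 0, r), 0, s)"
      unfolding M0_def carrier_DirProd[of H] by blast
    have "w \<otimes>\<^bsub>E\<^esub> n = n \<otimes>\<^bsub>E\<^esub> w" if n: "n \<in> N" for n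
    proof -
      obtain x' r' s' where n': "x' \<in> carrier (plane p)" "r' \<in> carrier R" "s' \<in> carrier R2"
        "n = (((\<one>\<^bsub>H\<^esub>, x'), 0, r'), 0, s')"
        using n unfolding N_def by blast
      have cl: "(h, x) \<in> carrier L" "(\<one>\<^bsub>H\<^esub>, x') \<in> carrier L" using w n' by simp_all
      have "(h, x) \<otimes>\<^bsub>L\<^esub> (\<one>\<^bsub>H\<^esub>, x') = (\<one>\<^bsub>H\<^esub>, x') \<otimes>\<^bsub>L\<^esub> (h, x)"
        using w(4) by (simp add: mult_DirProd' add.commute)
      then show ?thesis
        unfolding w(5) n'(4) commute_iff[OF cl(1) zero_in(1) w(2) zero_in(1) w(3) cl(2) zero_in(1) n'(2) zero_in(1) n'(3)]
        by simp
    qed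
    moreover have "w \<in> carrier E"
      unfolding w(5) E_def carrier_twist carrier_Zmod using w(1-4) zero_in by simp
    ultimately show "w \<in> centralizer E N" unfolding centralizer_def by blast
  qed
qed

section \<open>Orders, and the hypotheses of the criterion\<close>

lemma card_formulas:
  "card (carrier L) = card (carrier H) * p ^ 2"
  "card N = p ^ 3 * card (carrier R) * card (carrier R)"
  "card (center E) = card (center H) * card (carrier R) * card (carrier R) * p"
  "0 < card (carrier R)"
proof -
  show "card (carrier L) = card (carrier H) * p ^ 2"
    by (simp add: card_cartesian_product carrier_Zmod power2_eq_square)
  show "card N = p ^ 3 * card (carrier R) * card (carrier R)"
    unfolding N_def by (simp add: card_cartesian_product carrier_Zmod power3_eq_cube mult_ac)
  show "card (center E) = card (center H) * card (carrier R) * card (carrier R) * p"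
    unfolding card_center_E kernel_quot_hom by (simp add: card_cartesian_product)
  show "0 < card (carrier R)"
    using finite_R R.one_closed card_gt_0_iff by blast
qed

lemma cd_extension_E: "cd_extension E H emb N p"
proof (intro cd_extension.intro cd_extension_axioms.intro)
  show "group E" "group H" "finite (carrier E)" "carrier H \<in> CD_lattice H" "emb \<in> mon H E" "N \<lhd> E"
    by (fact group_E H.group_axioms finite_E H_in_CD emb_mon N_normal)+
  show "N \<inter> emb ` carrier H = {\<one>\<^bsub>E\<^esub>}" by (rule N_Int)
  show "centralizer E N = N <#>\<^bsub>E\<^esub> emb ` carrier H" unfolding set_mult_N by (rule centralizer_N)
  show "\<not> N \<subseteq> center E" by (rule N_not_central)
  show "n \<otimes>\<^bsub>E\<^esub> emb h = emb h \<otimes>\<^bsub>E\<^esub> n" if "n \<in> N" "h \<in> carrier H" for n h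
  proof -
    have "emb h \<in> M0" unfolding emb_def M0_def using that zero_in by simp
    then show ?thesis
      using that(1) unfolding centralizer_N[symmetric] centralizer_def by auto
  qed
  show "centralizer E {u} \<inter> (N <#>\<^bsub>E\<^esub> emb ` carrier H) \<subseteq> center E"
    and "card (centralizer E {u}) \<le> p * card (center E)"
    if u: "u \<in> carrier E" "u \<notin> N <#>\<^bsub>E\<^esub> emb ` carrier H" for u
  proof -
    obtain \<chi> where \<chi>: "\<chi> \<in> hom E (Zmod p)"
      "\<And>w. \<lbrakk>w \<in> centralizer E {u}; \<chi> w = 0\<rbrakk> \<Longrightarrow> w \<in> center E" "\<And>w. w \<in> M0 \<Longrightarrow> \<chi> w = 0"
      using separating_coordinate[OF u[unfolded set_mult_N]] by blast
    show "centralizer E {u} \<inter> (N <#>\<^bsub>E\<^esub> emb ` carrier H) \<subseteq> center E"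
      unfolding set_mult_N using \<chi>(2,3) by blast
    interpret E: group E by (rule group_E)
    have "subgroup (centralizer E {u}) E" using u(1) by (intro E.subgroup_centralizer) simp
    moreover have "finite (centralizer E {u})" "finite (center E)"
      using finite_subset[OF centralizer_subset finite_E] unfolding center_def by blast+
    ultimately show "card (centralizer E {u}) \<le> p * card (center E)"
      using E.card_le_kernel[OF _ _ \<chi>(1) p_pos _ \<chi>(2)] by blast
  qed
  have "card (center H) \<le> card (carrier H)"
    by (rule card_mono[OF finite_H subgroup.subset[OF H.subgroup_center]])
  moreover have H0: "0 < card (carrier H)" using finite_H H.one_closed card_gt_0_iff by blast
  \<comment> \<open>The factor p^2 coming from the plane makes this strict even when
    \<open>H\<close> is abelian.\<close>
  ultimately have lt: "card (center H) < card (carrier H) * p ^ 2"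
    using prime_gt_1_nat[OF prime]
    by (metis le_neq_implies_less less_le_trans mult.right_neutral nat_mult_less_cancel1 one_less_power
        order_le_less_trans pos2)
  have "0 < card (carrier R) * card (carrier R) * p ^ 3" using card_formulas(4) p_pos by simp
  then have "card (center H) * (card (carrier R) * card (carrier R) * p ^ 3)
      < card (carrier H) * p ^ 2 * (card (carrier R) * card (carrier R) * p ^ 3)"
    by (rule mult_less_mono1[OF lt])
  then show "p * p * card (center E) < card (carrier E)"
    unfolding card_formulas(3) card_E card_formulas(1) by (simp only: power3_eq_cube mult_ac)
  \<comment> \<open>Since |E| = |H| |R|^2 p^5, both sides equal |H| |Z(H)| |R|^4 p^6.\<close>
  show "card (carrier E) * card (center E) = card N * card N * (card (carrier H) * card (center H))"
    unfolding card_formulas(2,3) card_E card_formulas(1) by (simp only: power3_eq_cube power2_eq_square mult_ac)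
qed

text \<open>Apart from the coordinate in Z(H), a central element has only coordinates in groups of
  exponent dividing \<open>p\<close>.\<close>

lemma center_E_exponent:
  assumes "\<And>z. z \<in> center H \<Longrightarrow> z [^]\<^bsub>H\<^esub> p = \<one>\<^bsub>H\<^esub>" "x \<in> center E"
  shows "x [^]\<^bsub>E\<^esub> p = \<one>\<^bsub>E\<^esub>"
proof -
  have "x \<in> ((center H \<times> {(0, 0)}) \<times> {0} \<times> carrier R) \<times> {0} \<times> carrier R2"
    using assms(2) unfolding center_E kernel_quot_hom .
  then obtain h r s where x: "h \<in> center H" "r \<in> carrier R" "s \<in> carrier R2" "x = (((h, (0, 0)), 0, r), 0, s)"
    by blast
  have l: "(h, (0, 0)) \<in> carrier L"
    using x(1) subgroup.subset[OF H.subgroup_center] zero_in by auto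
  have "has_exponent R2 p" by (intro DirProd_has_exponent exponent Zmod_has_exponent)
  then have "s [^]\<^bsub>R2\<^esub> p = \<one>\<^bsub>R2\<^esub>" using x(3) unfolding has_exponent_def by blast
  moreover have "r [^]\<^bsub>R\<^esub> p = \<one>\<^bsub>R\<^esub>" using exponent x(2) unfolding has_exponent_def by blast
  moreover have "(h, (0, 0)) [^]\<^bsub>L\<^esub> p = (\<one>\<^bsub>H\<^esub>, (0, 0))"
    using assms(1)[OF x(1)] by (simp add: DirProd_nat_pow)
  ultimately show ?thesis unfolding x(4) E_nat_pow[OF l x(2,3)] one_E by simp
qed

text \<open>By Lagrange |H/Z(H)| divides a power of \<open>p\<close>, so |R| and |E| are powers of
  \<open>p\<close> too.\<close>

lemma order_E:
  assumes "card (carrier H) = p ^ n"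
  shows "\<exists>k. card (carrier E) = p ^ k"
proof -
  have "card (rcosets\<^bsub>H\<^esub> center H) * card (center H) = p ^ n"
    using H.lagrange[OF H.subgroup_center] assms unfolding order_def by simp
  then have "card (carrier (H Mod center H)) dvd p ^ n"
    unfolding FactGroup_def by (metis dvd_triv_left partial_object.select_convs(1))
  then obtain i where i: "card (carrier (H Mod center H)) = p ^ i"
    using divides_primepow_nat[OF prime] by blast
  have "card (carrier R) = p ^ (i + 2)"
    using i by (simp add: card_cartesian_product carrier_Zmod power_add power2_eq_square)
  then have "card (carrier E) = p ^ (n + 2 + (i + 2) + (i + 2) + 3)"
    unfolding card_E card_formulas(1) assms by (simp only: power_add)
  then show ?thesis by blast
qed

end

theorem mainTheorem1:
  fixes p :: nat and H :: "('a, 'b) monoid_scheme"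
  assumes "Factorial_Ring.prime p"
    and "finite_p_group p H"
    and "nilpotent H" and "nilpotency_class H \<le> 2"
    and "carrier H \<in> CD_lattice H"
    and "elementary_abelian p (H Mod center H)"
  shows "\<exists>(G :: nat monoid) \<phi> N.
    finite_p_group p G \<and> nilpotent G \<and> nilpotency_class G = 2 \<and>
    \<phi> \<in> mon H G \<and>
    N \<lhd> G \<and>
    N \<inter> \<phi> ` carrier H = {\<one>\<^bsub>G\<^esub>} \<and>
    center G \<subset> N <#>\<^bsub>G\<^esub> \<phi> ` center H \<and>
    N <#>\<^bsub>G\<^esub> \<phi> ` carrier H \<subset> carrier G \<and>
    elementary_abelian p (G Mod center G) \<and>
    CD_lattice G =
      {carrier G, center G} \<union> {N <#>\<^bsub>G\<^esub> \<phi> ` K | K. K \<in> CD_lattice H} \<and>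
    (elementary_abelian p (H\<lparr>carrier := center H\<rparr>) \<longrightarrow>
      elementary_abelian p (G\<lparr>carrier := center G\<rparr>))"
proof -
  have H: "group H" "finite (carrier H)" "\<exists>n. card (carrier H) = p ^ n"
    using assms(2) unfolding finite_p_group_def order_def by auto
  interpret C: cd_construction H p
    using H assms(1,5,6) by (intro cd_construction.intro cd_construction_axioms.intro)
  interpret E: group C.E by (rule C.group_E)
  obtain G :: "nat monoid" and f where G: "group G" and f: "f \<in> iso C.E G"
    using E.nat_isomorphic_copy[OF C.finite_E] .
  let ?\<phi> = "f \<circ> C.emb" and ?N = "f ` C.N"
  interpret X: cd_extension G H ?\<phi> ?N p
    by (rule cd_extension.iso_cd_extension[OF C.cd_extension_E f G])
  have surj: "carrier G = f ` carrier C.E" and inj: "inj_on f (carrier C.E)" and fh: "f \<in> hom C.E G"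
    using f unfolding iso_def bij_betw_def by auto
  have center: "center G = f ` center C.E"
    unfolding center_def[of G] center_def[of C.E]
    using iso_image_centralizer[OF f, of "carrier C.E"] surj by simp
  \<comment> \<open>The inverse isomorphism, which transfers \<open>C.\<theta>\<close> to a map on
    \<open>G\<close> with kernel Z(G).\<close>
  let ?g = "inv_into (carrier C.E) f"
  have g: "?g \<in> hom G C.E" using E.iso_set_sym[OF f] unfolding iso_def by simp
  interpret K: central_kernel G "C.R2 \<times>\<times> Zmod p" "C.\<theta> \<circ> ?g"
  proof (intro central_kernel.intro central_kernel_axioms.intro G C.comm_group_theta)
    show "C.\<theta> \<circ> ?g \<in> hom G (C.R2 \<times>\<times> Zmod p)"
      by (rule hom_compose[OF g C.theta_hom])
    fix x assume "x \<in> carrier G"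
    then obtain y where y: "y \<in> carrier C.E" "x = f y" unfolding surj by blast
    then have "x \<in> center G \<longleftrightarrow> y \<in> center C.E"
      unfolding center using inj subgroup.subset[OF E.subgroup_center] by (simp add: inj_on_image_mem_iff)
    then show "x \<in> center G \<longleftrightarrow> (C.\<theta> \<circ> ?g) x = \<one>\<^bsub>C.R2 \<times>\<times> Zmod p\<^esub>"
      using C.center_E_iff[OF y(1)] y inj by simp
  qed
  have "finite_p_group p G"
    unfolding finite_p_group_def order_def
    using G X.finite_G C.order_E H(3) card_image[OF inj] surj by metis
  \<comment> \<open>Otherwise \<open>N\<close> would be central in \<open>G\<close>.\<close>
  moreover have "center G \<noteq> carrier G"
    using X.N_not_central X.N_closed by blast
  then have "nilpotent G" "nilpotency_class G = 2" by (rule K.class_two)+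
  moreover have "elementary_abelian p (G Mod center G)"
    by (rule K.elementary_abelian_Mod_center[OF C.exponent_theta])
  moreover have "elementary_abelian p (G\<lparr>carrier := center G\<rparr>)"
    if "elementary_abelian p (H\<lparr>carrier := center H\<rparr>)"
  proof -
    have "z [^]\<^bsub>G\<^esub> p = \<one>\<^bsub>G\<^esub>" if z: "z \<in> center G" for z
    proof -
      obtain y where y: "y \<in> center C.E" "z = f y" using z unfolding center by blast
      have yE: "y \<in> carrier C.E" using y subgroup.subset[OF E.subgroup_center] by blast
      have "y [^]\<^bsub>C.E\<^esub> p = \<one>\<^bsub>C.E\<^esub>"
        using C.center_E_exponent y(1) \<open>elementary_abelian p (H\<lparr>carrier := center H\<rparr>)\<close>
        unfolding C.H.elementary_abelian_center_iff by blast
      then show ?thesis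
        using hom_nat_pow[OF fh yE E.group_axioms G, of p] hom_one[OF fh E.group_axioms G] y(2) by simp
    qed
    then show ?thesis unfolding X.G.elementary_abelian_center_iff by blast
  qed
  ultimately show ?thesis
    using X.mon X.normal_N X.N_Int X.center_psubset X.M_psubset X.CD_lattice_G
    by (intro exI[of _ G] exI[of _ ?\<phi>] exI[of _ ?N]) simp
qed

end
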